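(* Let $(M,J,g,G)$ be an almost anti-Hermitian manifold. For a linear connection $\nabla$ on $M$, let $\nabla^{\ast}$, $\nabla^{\dagger}$ and $\nabla^{J}$ denote respectively its $g$-conjugate, $G$-conjugate and $J$-conjugate connections. Then $(\mathrm{id},\ast,\dagger,J)$ acts as the 4-element Klein group on the space of linear connections on $M$; that is, for every linear connection $\nabla$ on $M$: i) $(\nabla^{\ast})^{\ast}=(\nabla^{\dagger})^{\dagger}=(\nabla^{J})^{J}=\nabla$; ii) $(\nabla^{\dagger})^{J}=(\nabla^{J})^{\dagger}=\nabla^{\ast}$; iii) $(\nabla^{\ast})^{J}=(\nabla^{J})^{\ast}=\nabla^{\dagger}$; iv) $(\nabla^{\ast})^{\dagger}=(\nabla^{\dagger})^{\ast}=\nabla^{J}$.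
   Context: An almost anti-Hermitian manifold $(M,J,g,G)$ is a smooth $2n$-dimensional manifold $M$ with an almost complex structure $J$ ($J^{2}=-\mathrm{id}$), a pseudo-Riemannian metric $g$ of neutral signature $(n,n)$ satisfying $g(JX,JY)=-g(X,Y)$, equivalently $g(JX,Y)=g(X,JY)$, for all vector fields $X,Y$, and the twin metric $G(X,Y)=(g\circ J)(X,Y)=g(JX,Y)$. A linear connection is a connection on $TM$ (not assumed torsion-free). For a linear connection $\nabla$, its $g$-conjugate $\nabla^{\ast}$ and $G$-conjugate $\nabla^{\dagger}$ are the linear connections determined by $$Zg(X,Y)=g(\nabla_Z X,Y)+g(X,\nabla^{\ast}_Z Y),\qquad ZG(X,Y)=G(\nabla_Z X,Y)+G(X,\nabla^{\dagger}_Z Y)$$ for all vector fields $X,Y,Z$. Its $J$-conjugate $\nabla^{J}$ is the linear connection $\nabla^{J}_X Y=J^{-1}(\nabla_X (JY))$. *)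

theory Defs
  imports "HOL-Analysis.Analysis"
begin

text \<open>
  \<open>C\<^sup>k\<close> and smooth maps; these are only ever used on open sets \<open>S\<close>, where \<open>at x\<close> and
  \<open>at x within S\<close> coincide.
\<close>

fun Ck_on :: "nat \<Rightarrow> 'a::euclidean_space set \<Rightarrow> ('a \<Rightarrow> 'b::real_normed_vector) \<Rightarrow> bool" where
  "Ck_on 0 S f \<longleftrightarrow> continuous_on S f"
| "Ck_on (Suc k) S f \<longleftrightarrow>
     f differentiable_on S \<and> (\<forall>v. Ck_on k S (\<lambda>x. frechet_derivative f (at x) v))"

definition smooth_on :: "'a::euclidean_space set \<Rightarrow> ('a \<Rightarrow> 'b::real_normed_vector) \<Rightarrow> bool" where
  "smooth_on S f \<longleftrightarrow> (\<forall>k. Ck_on k S f)"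

text \<open>
  Manifolds. The underlying topological space is the whole type \<open>'m\<close>, whose sort supplies the
  Hausdorff and second countability axioms. A chart is a pair of an open domain and a coordinate
  map, of which only the values on the domain matter. The atlas need not be maximal.
\<close>

type_synonym ('m, 'e) chart = "'m set \<times> ('m \<Rightarrow> 'e)"

definition chart :: "('m::topological_space, 'e::euclidean_space) chart \<Rightarrow> bool" where
  "chart c \<longleftrightarrow> (case c of (U, \<phi>) \<Rightarrow>
     open U \<and> open (\<phi> ` U) \<and> homeomorphism U (\<phi> ` U) \<phi> (inv_into U \<phi>))"

definition smooth_atlas ::
    "('m::{t2_space, second_countable_topology}, 'e::euclidean_space) chart set \<Rightarrow> bool" where
  "smooth_atlas A \<longleftrightarrow>
     (\<forall>c\<in>A. chart c) \<and>
     (\<Union>c\<in>A. fst c) = UNIV \<and>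
     (\<forall>(U, \<phi>)\<in>A. \<forall>(V, \<psi>)\<in>A. smooth_on (\<phi> ` (U \<inter> V)) (\<psi> \<circ> inv_into U \<phi>))"

definition smooth_fun ::
    "('m::topological_space, 'e::euclidean_space) chart set \<Rightarrow> ('m \<Rightarrow> real) \<Rightarrow> bool" where
  "smooth_fun A f \<longleftrightarrow> (\<forall>(U, \<phi>)\<in>A. smooth_on (\<phi> ` U) (f \<circ> inv_into U \<phi>))"

text \<open>
  Tangent vectors at \<open>p\<close> are the derivations at \<open>p\<close> of the algebra of smooth functions. They are
  set to 0 on non-smooth functions, so that HOL equality is equality of derivations and the
  vector space operations are the pointwise ones.
\<close>

type_synonym 'm tangent = "('m \<Rightarrow> real) \<Rightarrow> real"

definition tangent_space ::
    "('m::topological_space, 'e::euclidean_space) chart set \<Rightarrow> 'm \<Rightarrow> 'm tangent set" where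
  "tangent_space A p = {v.
     (\<forall>f h. smooth_fun A f \<longrightarrow> smooth_fun A h \<longrightarrow>
        v (\<lambda>x. f x + h x) = v f + v h \<and>
        v (\<lambda>x. f x * h x) = v f * h p + f p * v h) \<and>
     (\<forall>f c. smooth_fun A f \<longrightarrow> v (\<lambda>x. c * f x) = c * v f) \<and>
     (\<forall>f. \<not> smooth_fun A f \<longrightarrow> v f = 0)}"

definition tadd :: "'m tangent \<Rightarrow> 'm tangent \<Rightarrow> 'm tangent" where
  "tadd u v = (\<lambda>f. u f + v f)"

definition tscale :: "real \<Rightarrow> 'm tangent \<Rightarrow> 'm tangent" where
  "tscale c v = (\<lambda>f. c * v f)"

text \<open>A vector field \<open>X\<close> acts on functions by \<open>X f = (\<lambda>p. X p f)\<close>.\<close>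

type_synonym 'm field = "'m \<Rightarrow> 'm tangent"

definition vector_fields ::
    "('m::topological_space, 'e::euclidean_space) chart set \<Rightarrow> 'm field set" where
  "vector_fields A = {X.
     (\<forall>p. X p \<in> tangent_space A p) \<and>
     (\<forall>f. smooth_fun A f \<longrightarrow> smooth_fun A (\<lambda>p. X p f))}"

definition fadd :: "'m field \<Rightarrow> 'm field \<Rightarrow> 'm field" where
  "fadd X Y = (\<lambda>p. tadd (X p) (Y p))"

definition fscale :: "('m \<Rightarrow> real) \<Rightarrow> 'm field \<Rightarrow> 'm field" where
  "fscale f X = (\<lambda>p. tscale (f p) (X p))"

text \<open>
  Tensor fields are given pointwise; only their values on the tangent spaces are meaningful.
\<close>

type_synonym 'm endomorphism = "'m \<Rightarrow> 'm tangent \<Rightarrow> 'm tangent"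
type_synonym 'm bilinear_form = "'m \<Rightarrow> 'm tangent \<Rightarrow> 'm tangent \<Rightarrow> real"

definition almost_complex_structure ::
    "('m::topological_space, 'e::euclidean_space) chart set \<Rightarrow> 'm endomorphism \<Rightarrow> bool" where
  "almost_complex_structure A J \<longleftrightarrow>
     (\<forall>p. \<forall>u\<in>tangent_space A p.
        J p u \<in> tangent_space A p \<and>
        J p (J p u) = tscale (-1) u \<and>
        (\<forall>c. J p (tscale c u) = tscale c (J p u)) \<and>
        (\<forall>v\<in>tangent_space A p. J p (tadd u v) = tadd (J p u) (J p v))) \<and>
     (\<forall>X\<in>vector_fields A. (\<lambda>p. J p (X p)) \<in> vector_fields A)"

definition pseudo_riemannian_metric ::
    "('m::topological_space, 'e::euclidean_space) chart set \<Rightarrow> 'm bilinear_form \<Rightarrow> bool" where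
  "pseudo_riemannian_metric A g \<longleftrightarrow>
     (\<forall>p. \<forall>u\<in>tangent_space A p. \<forall>v\<in>tangent_space A p.
        g p u v = g p v u \<and>
        (\<forall>c. g p (tscale c u) v = c * g p u v) \<and>
        (\<forall>w\<in>tangent_space A p. g p (tadd u w) v = g p u v + g p w v)) \<and>
     (\<forall>p. \<forall>u\<in>tangent_space A p.
        (\<forall>v\<in>tangent_space A p. g p u v = 0) \<longrightarrow> u = (\<lambda>f. 0)) \<and>
     (\<forall>X\<in>vector_fields A. \<forall>Y\<in>vector_fields A. smooth_fun A (\<lambda>p. g p (X p) (Y p)))"

text \<open>
  The signature is \<open>(r, s)\<close> if every tangent space has an orthonormal basis with \<open>r\<close> vectors of
  square 1 and \<open>s\<close> of square -1. Linear independence is a consequence of orthonormality.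
\<close>

definition has_signature ::
    "('m::topological_space, 'e::euclidean_space) chart set \<Rightarrow> 'm bilinear_form \<Rightarrow> nat \<Rightarrow> nat \<Rightarrow> bool"
  where
  "has_signature A g r s \<longleftrightarrow>
     (\<forall>p. \<exists>e :: nat \<Rightarrow> 'm tangent.
        (\<forall>i<r + s. e i \<in> tangent_space A p) \<and>
        (\<forall>v\<in>tangent_space A p. \<exists>c :: nat \<Rightarrow> real. v = (\<lambda>f. \<Sum>i<r + s. c i * e i f)) \<and>
        (\<forall>i<r + s. \<forall>j<r + s.
           g p (e i) (e j) = (if i \<noteq> j then 0 else if i < r then 1 else -1)))"

definition twin_metric :: "'m endomorphism \<Rightarrow> 'm bilinear_form \<Rightarrow> 'm bilinear_form" where
  "twin_metric J g = (\<lambda>p u v. g p (J p u) v)"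

definition almost_anti_Hermitian ::
    "nat \<Rightarrow> ('m::{t2_space, second_countable_topology}, 'e::euclidean_space) chart set \<Rightarrow>
     'm endomorphism \<Rightarrow> 'm bilinear_form \<Rightarrow> 'm bilinear_form \<Rightarrow> bool" where
  "almost_anti_Hermitian n A J g G \<longleftrightarrow>
     smooth_atlas A \<and> DIM('e) = 2 * n \<and>
     almost_complex_structure A J \<and>
     pseudo_riemannian_metric A g \<and> has_signature A g n n \<and>
     (\<forall>p. \<forall>u\<in>tangent_space A p. \<forall>v\<in>tangent_space A p. g p (J p u) (J p v) = - g p u v) \<and>
     G = twin_metric J g"

text \<open>
  Connections on the tangent bundle, with \<open>D X Y\<close> for the covariant derivative of \<open>Y\<close> along \<open>X\<close>.
  They are extensional functions, so that HOL equality is equality as operators on vector fields.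
  Real linearity in \<open>Y\<close> follows from additivity and the Leibniz rule for constant functions.
\<close>

type_synonym 'm connection = "'m field \<Rightarrow> 'm field \<Rightarrow> 'm field"

definition linear_connections ::
    "('m::topological_space, 'e::euclidean_space) chart set \<Rightarrow> 'm connection set" where
  "linear_connections A = {D \<in> vector_fields A \<rightarrow>\<^sub>E vector_fields A \<rightarrow>\<^sub>E vector_fields A.
     \<forall>X\<in>vector_fields A. \<forall>Y\<in>vector_fields A.
       (\<forall>X'\<in>vector_fields A. D (fadd X X') Y = fadd (D X Y) (D X' Y)) \<and>
       (\<forall>Y'\<in>vector_fields A. D X (fadd Y Y') = fadd (D X Y) (D X Y')) \<and>
       (\<forall>f. smooth_fun A f \<longrightarrow>
          D (fscale f X) Y = fscale f (D X Y) \<and>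
          D X (fscale f Y) = fadd (fscale (\<lambda>p. X p f) Y) (fscale f (D X Y)))}"

definition is_metric_conjugate ::
    "('m::topological_space, 'e::euclidean_space) chart set \<Rightarrow> 'm bilinear_form \<Rightarrow>
     'm connection \<Rightarrow> 'm connection \<Rightarrow> bool" where
  "is_metric_conjugate A h D D' \<longleftrightarrow>
     D' \<in> linear_connections A \<and>
     (\<forall>X\<in>vector_fields A. \<forall>Y\<in>vector_fields A. \<forall>Z\<in>vector_fields A. \<forall>p.
        Z p (\<lambda>q. h q (X q) (Y q)) = h p (D Z X p) (Y p) + h p (X p) (D' Z Y p))"

definition metric_conjugate ::
    "('m::topological_space, 'e::euclidean_space) chart set \<Rightarrow> 'm bilinear_form \<Rightarrow>
     'm connection \<Rightarrow> 'm connection" where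
  "metric_conjugate A h D = (THE D'. is_metric_conjugate A h D D')"

definition J_conjugate ::
    "('m::topological_space, 'e::euclidean_space) chart set \<Rightarrow> 'm endomorphism \<Rightarrow>
     'm connection \<Rightarrow> 'm connection" where
  "J_conjugate A J D = (\<lambda>X\<in>vector_fields A. \<lambda>Y\<in>vector_fields A.
     \<lambda>p. inv_into (tangent_space A p) (J p) (D X (\<lambda>q. J q (Y q)) p))"

end

theory Submission
  imports Defs
begin

text \<open>
  Write \<open>*\<close>, \<open>\<dagger>\<close> and \<open>J\<close> for the conjugations with respect to \<open>g\<close>, \<open>G\<close> and \<open>J\<close>. Two facts generate the whole
  multiplication table: \<open>J\<close> and \<open>*\<close> are commuting involutions, and \<open>\<dagger>\<close> is \<open>*\<close> followed by \<open>J\<close>. The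
  J-conjugation is an involution because \<open>J\<^sup>2 = -1\<close> and a connection commutes with multiplication by
  -1; the g-conjugation is one because \<open>g\<close> is symmetric. For the other two statements,
  differentiate \<open>G X Y = g X (J Y)\<close> and \<open>g X Y = - g (J X) (J Y)\<close> along \<open>Z\<close>. By the defining rule of the
  g-conjugate, and because \<open>J\<close> is self-adjoint, the results show that the J-conjugate of the
  g-conjugate of a connection is its G-conjugate, and that it is also the g-conjugate of its
  J-conjugate (\<open>J_conjugate_metric_conjugate\<close>). Conjugates with respect to a nondegenerate metric
  are unique (\<open>metric_conjugate_eqI\<close>).

  What remains is that a g-conjugate exists at all, and this is the bulk of the work. For given \<open>Z\<close>
  and \<open>Y\<close> one needs a smooth field \<open>W\<close> with \<open>g X W = Z (g X Y) - g (D Z X) Y\<close> for all \<open>X\<close>. The right hand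
  side is linear in \<open>X\<close> over the smooth functions, and every such functional is of the form \<open>g X W\<close>
  (\<open>functional_representation\<close>). Tangent vectors are derivations and vector fields are global, so
  this requires local frames of global fields. They are obtained from coordinate derivatives,
  multiplied with bump functions (\<open>cut_off_coordinate_fields\<close>). That they span is a
  dimension count: an orthonormal basis, which exists by the hypothesis on the signature, has as many
  vectors as there are coordinates (\<open>injective_imp_onto_tangent_space\<close>). Finally, Cramer's rule for
  the Gram matrix of such a frame, with cleared denominators (\<open>cramer_frame\<close>), shows both that the
  functional depends on \<open>X\<close> pointwise and that the representing field is smooth.
\<close>

section \<open>Calculus of \<open>C\<^sup>k\<close> maps and a bump function\<close>

lemma Ck_on_subset: "Ck_on k S f \<Longrightarrow> T \<subseteq> S \<Longrightarrow> Ck_on k T f"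
  by (induction k arbitrary: f) (auto intro: continuous_on_subset differentiable_on_subset)

lemma differentiable_at_transform_open:
  assumes "f differentiable (at x)" "open S" "x \<in> S" "\<And>y. y \<in> S \<Longrightarrow> f y = g y"
  shows "g differentiable (at x)" and "frechet_derivative f (at x) = frechet_derivative g (at x)"
proof -
  have "(f has_derivative frechet_derivative f (at x)) (at x)"
    using assms(1) frechet_derivative_works by blast
  then have *: "(g has_derivative frechet_derivative f (at x)) (at x)"
    using has_derivative_transform_within_open assms by blast
  show "g differentiable (at x)" using * differentiable_def by blast
  show "frechet_derivative f (at x) = frechet_derivative g (at x)"
    using frechet_derivative_at[OF *] .
qed

text \<open>
  Values outside \<open>S\<close> do not matter because a Frechet derivative at a point of an open set is
  determined by the values on that set.
\<close>

lemma Ck_on_cong: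
  assumes "open S" "\<And>x. x \<in> S \<Longrightarrow> f x = g x" "Ck_on k S f"
  shows "Ck_on k S g"
  using assms(2,3)
proof (induction k arbitrary: f g)
  case 0
  then show ?case by (simp cong: continuous_on_cong)
next
  case (Suc k)
  have d: "f differentiable (at x)" if "x \<in> S" for x
    using Suc.prems(2) that assms(1) by (simp add: differentiable_on_eq_differentiable_at)
  have "g differentiable_on S"
    using differentiable_at_transform_open(1)[OF d assms(1)] Suc.prems(1)
    by (simp add: differentiable_at_imp_differentiable_on)
  moreover have "Ck_on k S (\<lambda>x. frechet_derivative g (at x) v)" for v
  proof (rule Suc.IH[of "\<lambda>x. frechet_derivative f (at x) v"])
    show "frechet_derivative f (at x) v = frechet_derivative g (at x) v" if "x \<in> S" for x
      using differentiable_at_transform_open(2)[OF d[OF that] assms(1) that Suc.prems(1)] by simp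
    show "Ck_on k S (\<lambda>x. frechet_derivative f (at x) v)" using Suc.prems(2) by simp
  qed
  ultimately show ?case by simp
qed

lemma Ck_on_local:
  assumes "\<And>x. x \<in> S \<Longrightarrow> \<exists>T. open T \<and> x \<in> T \<and> Ck_on k T f"
  shows "Ck_on k S f"
  using assms
proof (induction k arbitrary: f)
  case 0
  have "isCont f x" if "x \<in> S" for x
    using 0[OF that] by (auto simp: continuous_on_eq_continuous_at)
  then show ?case by (simp add: continuous_at_imp_continuous_on)
next
  case (Suc k)
  have "f differentiable (at x)" if "x \<in> S" for x
    using Suc.prems[OF that] by (auto simp: differentiable_on_eq_differentiable_at)
  moreover have "Ck_on k S (\<lambda>x. frechet_derivative f (at x) v)" for v
  proof (rule Suc.IH)
    fix x assume "x \<in> S"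
    then obtain T where "open T" "x \<in> T" "Ck_on (Suc k) T f" using Suc.prems by blast
    then show "\<exists>T. open T \<and> x \<in> T \<and> Ck_on k T (\<lambda>x. frechet_derivative f (at x) v)"
      by (intro exI[of _ T]) simp
  qed
  ultimately show ?case by (simp add: differentiable_at_imp_differentiable_on)
qed

lemma Ck_on_SucD: "Ck_on (Suc k) S f \<Longrightarrow> Ck_on k S f"
  by (induction k arbitrary: f) (auto intro: differentiable_imp_continuous_on)

text \<open>
  The successor clause of \<open>Ck_on\<close> speaks of \<open>frechet_derivative\<close>; this introduction rule and the
  elimination rule below exchange it for any derivative \<open>f'\<close>, so that the inductions that follow
  can use the differentiation rules.
\<close>

lemma Ck_on_SucI:
  assumes "open S" "\<And>x. x \<in> S \<Longrightarrow> (f has_derivative f' x) (at x)"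
    "\<And>v. Ck_on k S (\<lambda>x. f' x v)"
  shows "Ck_on (Suc k) S f"
proof -
  have "f differentiable_on S"
    using assms(2) by (meson differentiable_at_imp_differentiable_on differentiable_def)
  moreover have "Ck_on k S (\<lambda>x. frechet_derivative f (at x) v)" for v
    by (rule Ck_on_cong[OF assms(1) _ assms(3)[of v]])
       (simp add: frechet_derivative_at[OF assms(2), symmetric])
  ultimately show ?thesis by simp
qed

lemma Ck_on_SucE:
  assumes "open S" "Ck_on (Suc k) S f"
  obtains f' where "\<And>x. x \<in> S \<Longrightarrow> (f has_derivative f' x) (at x)"
    "\<And>v. Ck_on k S (\<lambda>x. f' x v)"
proof (rule that[of "\<lambda>x. frechet_derivative f (at x)"])
  show "(f has_derivative frechet_derivative f (at x)) (at x)" if "x \<in> S" for x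
    using assms that by (simp add: differentiable_on_eq_differentiable_at frechet_derivative_works)
  show "Ck_on k S (\<lambda>x. frechet_derivative f (at x) v)" for v
    using assms(2) by simp
qed

lemma Ck_on_const: "Ck_on k S (\<lambda>x. c)"
  by (induction k arbitrary: c) auto

lemma Ck_on_bounded_linear:
  assumes "open S" "bounded_linear L" shows "Ck_on k S L"
proof (cases k)
  case 0
  then show ?thesis using assms(2) by (simp add: linear_continuous_on)
next
  case (Suc j)
  show ?thesis unfolding Suc
    by (rule Ck_on_SucI[OF assms(1), where f' = "\<lambda>_. L"])
       (auto intro: bounded_linear_imp_has_derivative assms Ck_on_const)
qed

lemma Ck_on_linear_comp:
  assumes "open S" "bounded_linear L"
  shows "Ck_on k S f \<Longrightarrow> Ck_on k S (\<lambda>x. L (f x))"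
proof (induction k arbitrary: f)
  case 0
  then show ?case using assms(2) by (simp add: linear_continuous_on bounded_linear.continuous_on)
next
  case (Suc k)
  obtain f' where f': "\<And>x. x \<in> S \<Longrightarrow> (f has_derivative f' x) (at x)" "\<And>v. Ck_on k S (\<lambda>x. f' x v)"
    using Ck_on_SucE[OF assms(1) Suc.prems] by blast
  show ?case
    by (rule Ck_on_SucI[OF assms(1), where f' = "\<lambda>x v. L (f' x v)"])
       (auto intro: f' Suc.IH bounded_linear.has_derivative[OF assms(2)])
qed

lemma Ck_on_add:
  assumes "open S"
  shows "Ck_on k S f \<Longrightarrow> Ck_on k S g \<Longrightarrow> Ck_on k S (\<lambda>x. f x + g x)"
proof (induction k arbitrary: f g)
  case 0
  then show ?case by (auto intro: continuous_intros)
next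
  case (Suc k)
  obtain f' where f': "\<And>x. x \<in> S \<Longrightarrow> (f has_derivative f' x) (at x)" "\<And>v. Ck_on k S (\<lambda>x. f' x v)"
    using Ck_on_SucE[OF assms Suc.prems(1)] by blast
  obtain g' where g': "\<And>x. x \<in> S \<Longrightarrow> (g has_derivative g' x) (at x)" "\<And>v. Ck_on k S (\<lambda>x. g' x v)"
    using Ck_on_SucE[OF assms Suc.prems(2)] by blast
  show ?case
    by (rule Ck_on_SucI[OF assms, where f' = "\<lambda>x v. f' x v + g' x v"])
       (auto intro: f' g' Suc.IH has_derivative_add)
qed

lemma Ck_on_sum:
  assumes "open S"
  shows "(\<And>i. i \<in> I \<Longrightarrow> Ck_on k S (f i)) \<Longrightarrow> Ck_on k S (\<lambda>x. \<Sum>i\<in>I. f i x)"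
  by (induction I rule: infinite_finite_induct) (auto intro: Ck_on_add[OF assms] Ck_on_const)

lemma Ck_on_mult:
  fixes f g :: "'a::euclidean_space \<Rightarrow> real"
  assumes "open S"
  shows "Ck_on k S f \<Longrightarrow> Ck_on k S g \<Longrightarrow> Ck_on k S (\<lambda>x. f x * g x)"
proof (induction k arbitrary: f g)
  case 0
  then show ?case by (auto intro: continuous_intros)
next
  case (Suc k)
  obtain f' where f': "\<And>x. x \<in> S \<Longrightarrow> (f has_derivative f' x) (at x)" "\<And>v. Ck_on k S (\<lambda>x. f' x v)"
    using Ck_on_SucE[OF assms Suc.prems(1)] by blast
  obtain g' where g': "\<And>x. x \<in> S \<Longrightarrow> (g has_derivative g' x) (at x)" "\<And>v. Ck_on k S (\<lambda>x. g' x v)"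
    using Ck_on_SucE[OF assms Suc.prems(2)] by blast
  show ?case
    by (rule Ck_on_SucI[OF assms, where f' = "\<lambda>x v. f x * g' x v + f' x v * g x"])
       (auto intro!: f' g' Suc.IH Ck_on_add[OF assms] has_derivative_mult
         Ck_on_SucD[OF Suc.prems(1)] Ck_on_SucD[OF Suc.prems(2)])
qed

text \<open>
  The derivative of \<open>1 / f\<close> is \<open>- f' / f\<^sup>2\<close>, in which \<open>1 / f\<close> itself is \<open>C\<^sup>k\<close> by induction.
\<close>

lemma Ck_on_inverse:
  fixes f :: "'a::euclidean_space \<Rightarrow> real"
  assumes "open S" "\<And>x. x \<in> S \<Longrightarrow> f x \<noteq> 0"
  shows "Ck_on k S f \<Longrightarrow> Ck_on k S (\<lambda>x. inverse (f x))"
proof (induction k)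
  case 0
  then show ?case using assms by (auto intro: continuous_intros)
next
  case (Suc k)
  obtain f' where f': "\<And>x. x \<in> S \<Longrightarrow> (f has_derivative f' x) (at x)" "\<And>v. Ck_on k S (\<lambda>x. f' x v)"
    using Ck_on_SucE[OF assms(1) Suc.prems] by blast
  have IH: "Ck_on k S (\<lambda>x. inverse (f x))" using Suc Ck_on_SucD by blast
  show ?case
  proof (rule Ck_on_SucI[OF assms(1), where f' = "\<lambda>x v. (-1) * (inverse (f x) * f' x v * inverse (f x))"])
    show "((\<lambda>x. inverse (f x)) has_derivative (\<lambda>v. (-1) * (inverse (f x) * f' x v * inverse (f x)))) (at x)"
      if "x \<in> S" for x
      using Deriv.has_derivative_inverse[OF assms(2)[OF that] f'(1)[OF that]] by simp
    show "Ck_on k S (\<lambda>x. (-1) * (inverse (f x) * f' x v * inverse (f x)))" for v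
      by (intro Ck_on_mult[OF assms(1)] Ck_on_const IH f'(2))
  qed
qed

text \<open>
  The chain rule is written in coordinates, \<open>\<Sum>b. (h' v \<bullet> b) * f' b\<close>, because \<open>Ck_on\<close> controls the
  derivatives of \<open>f\<close> in fixed directions \<open>b\<close> only, while the direction \<open>h' v\<close> varies with the
  point.
\<close>

lemma Ck_on_compose:
  fixes f :: "'b::euclidean_space \<Rightarrow> real" and h :: "'a::euclidean_space \<Rightarrow> 'b"
  assumes "open S" "open T" "h ` S \<subseteq> T"
  shows "Ck_on k T f \<Longrightarrow> Ck_on k S h \<Longrightarrow> Ck_on k S (\<lambda>x. f (h x))"
proof (induction k arbitrary: f)
  case 0
  then show ?case using assms(3) by (auto intro: continuous_on_compose2)
next
  case (Suc k)
  obtain f' where f': "\<And>x. x \<in> T \<Longrightarrow> (f has_derivative f' x) (at x)" "\<And>v. Ck_on k T (\<lambda>x. f' x v)"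
    using Ck_on_SucE[OF assms(2) Suc.prems(1)] by blast
  obtain h' where h': "\<And>x. x \<in> S \<Longrightarrow> (h has_derivative h' x) (at x)" "\<And>v. Ck_on k S (\<lambda>x. h' x v)"
    using Ck_on_SucE[OF assms(1) Suc.prems(2)] by blast
  show ?case
  proof (rule Ck_on_SucI[OF assms(1), where f' = "\<lambda>x v. \<Sum>b\<in>Basis. (h' x v \<bullet> b) * f' (h x) b"])
    fix x assume x: "x \<in> S"
    have hx: "h x \<in> T" using x assms(3) by auto
    have lin: "linear (f' (h x))"
      using f'(1)[OF hx] has_derivative_linear by blast
    have "f' (h x) (h' x v) = (\<Sum>b\<in>Basis. (h' x v \<bullet> b) * f' (h x) b)" for v
    proof -
      have "f' (h x) (h' x v) = f' (h x) (\<Sum>b\<in>Basis. (h' x v \<bullet> b) *\<^sub>R b)"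
        by (simp add: euclidean_representation)
      then show ?thesis by (simp add: linear_sum[OF lin] linear_cmul[OF lin])
    qed
    moreover have "((\<lambda>x. f (h x)) has_derivative (\<lambda>v. f' (h x) (h' x v))) (at x)"
      using has_derivative_compose[OF h'(1)[OF x] f'(1)[OF hx]] .
    ultimately show "((\<lambda>x. f (h x)) has_derivative (\<lambda>v. \<Sum>b\<in>Basis. (h' x v \<bullet> b) * f' (h x) b)) (at x)"
      by simp
  next
    fix v
    show "Ck_on k S (\<lambda>x. \<Sum>b\<in>Basis. (h' x v \<bullet> b) * f' (h x) b)"
      by (intro Ck_on_sum[OF assms(1)] Ck_on_mult[OF assms(1)] Suc.IH f'(2) Ck_on_SucD[OF Suc.prems(2)]
         Ck_on_linear_comp[OF assms(1) bounded_linear_inner_left] h'(2))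
  qed
qed

text \<open>
  The case \<open>n = 0\<close> is the function \<open>exp (-1/t)\<close> extended by 0, from which bump functions are made.
  The factor \<open>t\<^sup>-\<^sup>n\<close> is there to make the family closed under differentiation.
\<close>

definition flat :: "nat \<Rightarrow> real \<Rightarrow> real" where
  "flat n t = (if t > 0 then (1 / t) ^ n * exp (- (1 / t)) else 0)"

lemma flat_tendsto_0: "(flat n \<longlongrightarrow> 0) (at 0)"
proof -
  have "((\<lambda>x. x ^ n / exp x) \<longlongrightarrow> (0::real)) at_top"
    by (rule tendsto_power_div_exp_0)
  then have "((\<lambda>t. (1/t) ^ n * exp (- (1/t))) \<longlongrightarrow> (0::real)) (at_right 0)"
    unfolding filterlim_at_top_to_right by (simp add: exp_minus divide_inverse)
  then have r: "(flat n \<longlongrightarrow> 0) (at_right 0)"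
    by (rule Lim_transform_eventually) (auto simp: flat_def eventually_at_filter)
  have "\<forall>\<^sub>F t in at_left 0. flat n t = 0"
    by (auto simp: flat_def eventually_at_filter)
  then have "(flat n \<longlongrightarrow> 0) (at_left 0)" using tendsto_eventually by blast
  with r show ?thesis by (simp add: filterlim_at_split)
qed

text \<open>
  At \<open>t = 0\<close> the difference quotient of \<open>flat n\<close> is \<open>flat (n + 1)\<close>, which tends to 0.
\<close>

lemma flat_has_derivative:
  "(flat n has_real_derivative (flat (n + 2) t - n * flat (n + 1) t)) (at t)"
proof -
  consider "t < 0" | "t = 0" | "t > 0" by linarith
  then show ?thesis
  proof cases
    case 1
    have "((\<lambda>_. 0) has_real_derivative 0) (at t)" by simp
    then have "(flat n has_real_derivative 0) (at t)"
      by (rule has_field_derivative_transform_within_open[where S = "{..<0}"])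
         (use 1 in \<open>auto simp: flat_def\<close>)
    then show ?thesis using 1 by (simp add: flat_def)
  next
    case 2
    have "((\<lambda>h. (flat n h - flat n 0) / h) \<longlongrightarrow> 0) (at 0)"
      by (rule Lim_transform_eventually[OF flat_tendsto_0[of "Suc n"]])
         (auto simp: flat_def eventually_at_filter)
    then show ?thesis using 2 by (simp add: has_field_derivative_iff flat_def)
  next
    case 3
    have inv: "((\<lambda>t. 1 / t) has_real_derivative - ((1 / t)\<^sup>2)) (at t)"
      using 3 by (auto intro!: derivative_eq_intros simp: power2_eq_square)
    have "((\<lambda>t. (1 / t) ^ n) has_real_derivative - (n * (1 / t) ^ (n + 1))) (at t)"
    proof (cases n)
      case (Suc m)
      show ?thesis unfolding Suc
        by (rule DERIV_cong[OF DERIV_power_Suc[OF inv]]) (simp add: power2_eq_square)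
    qed simp
    from DERIV_mult[OF this DERIV_fun_exp[OF DERIV_minus[OF inv]]]
    have "((\<lambda>t. (1 / t) ^ n * exp (- (1 / t))) has_real_derivative
       (flat (n + 2) t - n * flat (n + 1) t)) (at t)"
      by (rule DERIV_cong) (use 3 in \<open>simp add: flat_def power2_eq_square mult_ac\<close>)
    then show ?thesis
      by (rule has_field_derivative_transform_within_open[where S = "{0<..}"])
         (use 3 in \<open>auto simp: flat_def\<close>)
  qed
qed

lemma Ck_on_flat: "Ck_on k UNIV (flat n)"
proof (induction k arbitrary: n)
  case 0
  then show ?case
    using DERIV_isCont[OF flat_has_derivative] by (simp add: continuous_at_imp_continuous_on)
next
  case (Suc k)
  show ?case
  proof (rule Ck_on_SucI[where f' = "\<lambda>x v. (flat (n + 2) x + (- real n) * flat (n + 1) x) * v"])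
    show "(flat n has_derivative (\<lambda>v. (flat (n + 2) x + (- real n) * flat (n + 1) x) * v)) (at x)" for x
      using flat_has_derivative[of n x] by (simp add: has_field_derivative_def)
    show "Ck_on k UNIV (\<lambda>x. (flat (n + 2) x + (- real n) * flat (n + 1) x) * v)" for v
      by (intro Ck_on_mult Ck_on_add Ck_on_const Suc.IH) auto
  qed simp
qed

lemma Ck_on_ball_bump:
  fixes c :: "'a::euclidean_space"
  shows "Ck_on k UNIV (\<lambda>x. flat 0 (r\<^sup>2 - (dist c x)\<^sup>2))"
proof (rule Ck_on_compose[where T = UNIV and f = "flat 0"])
  have lin: "Ck_on k UNIV (\<lambda>x::'a. x \<bullet> b + - (c \<bullet> b))" for b
    by (intro Ck_on_add Ck_on_const Ck_on_bounded_linear bounded_linear_inner_left open_UNIV)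
  have "Ck_on k UNIV (\<lambda>x::'a. r\<^sup>2 + (-1) * (\<Sum>b\<in>Basis. (x \<bullet> b + - (c \<bullet> b)) * (x \<bullet> b + - (c \<bullet> b))))"
    by (intro Ck_on_add Ck_on_const Ck_on_mult Ck_on_sum lin open_UNIV)
  moreover have "(dist c x)\<^sup>2 = (\<Sum>b\<in>Basis. (x \<bullet> b + - (c \<bullet> b)) * (x \<bullet> b + - (c \<bullet> b)))" for x :: 'a
  proof -
    have "(dist c x)\<^sup>2 = (x - c) \<bullet> (x - c)" by (metis dist_norm norm_minus_commute power2_norm_eq_inner)
    then show ?thesis using euclidean_inner[of "x - c" "x - c"] by (simp add: inner_diff_left)
  qed
  ultimately show "Ck_on k UNIV (\<lambda>x::'a. r\<^sup>2 - (dist c x)\<^sup>2)" by simp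
qed (auto intro: Ck_on_flat)

section \<open>Smooth functions and vector fields\<close>

lemma smooth_on_Ck: "smooth_on S f \<Longrightarrow> Ck_on k S f" by (simp add: smooth_on_def)

locale smooth_manifold =
  fixes A :: "('m::{t2_space, second_countable_topology}, 'e::euclidean_space) chart set"
  assumes atlas: "smooth_atlas A"
begin

lemma chart_facts:
  assumes "(U, \<phi>) \<in> A"
  shows "open U" "open (\<phi> ` U)" "inj_on \<phi> U" "continuous_on U \<phi>" "continuous_on (\<phi> ` U) (inv_into U \<phi>)"
proof -
  have "chart (U, \<phi>)" using atlas assms unfolding smooth_atlas_def by blast
  then have *: "open U" "open (\<phi> ` U)" "homeomorphism U (\<phi> ` U) \<phi> (inv_into U \<phi>)"
    by (simp_all add: chart_def)
  then show "open U" "open (\<phi> ` U)" "continuous_on U \<phi>" "continuous_on (\<phi> ` U) (inv_into U \<phi>)"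
    by (simp_all add: homeomorphism_def)
  show "inj_on \<phi> U" using *(3) by (auto simp: homeomorphism_def intro: inj_on_inverseI)
qed

lemma chart_around: obtains U \<phi> where "(U, \<phi>) \<in> A" "p \<in> U"
proof -
  have "p \<in> (\<Union>c\<in>A. fst c)" using atlas by (simp add: smooth_atlas_def)
  then show ?thesis using that by force
qed

lemma transition_smooth:
  "(U, \<phi>) \<in> A \<Longrightarrow> (V, \<psi>) \<in> A \<Longrightarrow> smooth_on (\<phi> ` (U \<inter> V)) (\<psi> \<circ> inv_into U \<phi>)"
  using atlas unfolding smooth_atlas_def by fast

lemma chart_open_image:
  assumes "(U, \<phi>) \<in> A" "open N" shows "open (\<phi> ` (U \<inter> N))"
proof -
  note c = chart_facts[OF assms(1)]
  have "open (inv_into U \<phi> -` N \<inter> \<phi> ` U)"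
    using continuous_on_open_vimage[OF c(2)] c(5) assms(2) by blast
  moreover have "inv_into U \<phi> -` N \<inter> \<phi> ` U = \<phi> ` (U \<inter> N)" using c(3) by auto
  ultimately show ?thesis by simp
qed

lemma smooth_fun_Ck: "smooth_fun A f \<Longrightarrow> (U, \<phi>) \<in> A \<Longrightarrow> Ck_on k (\<phi> ` U) (\<lambda>y. f (inv_into U \<phi> y))"
  by (auto simp: smooth_fun_def smooth_on_def o_def)

lemma smooth_funI:
  "(\<And>U \<phi> k. (U, \<phi>) \<in> A \<Longrightarrow> Ck_on k (\<phi> ` U) (\<lambda>y. f (inv_into U \<phi> y))) \<Longrightarrow> smooth_fun A f"
  by (auto simp: smooth_fun_def smooth_on_def o_def)

lemma smooth_fun_const: "smooth_fun A (\<lambda>x. c)"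
  by (intro smooth_funI Ck_on_const)

lemma smooth_fun_add: "smooth_fun A f \<Longrightarrow> smooth_fun A h \<Longrightarrow> smooth_fun A (\<lambda>x. f x + h x)"
  by (rule smooth_funI, rule Ck_on_add) (simp_all add: smooth_fun_Ck chart_facts)

lemma smooth_fun_mult: "smooth_fun A f \<Longrightarrow> smooth_fun A h \<Longrightarrow> smooth_fun A (\<lambda>x. f x * h x)"
  by (rule smooth_funI, rule Ck_on_mult) (simp_all add: smooth_fun_Ck chart_facts)

lemma smooth_fun_cmult: "smooth_fun A f \<Longrightarrow> smooth_fun A (\<lambda>x. c * f x)"
  by (intro smooth_fun_mult smooth_fun_const)

lemma smooth_fun_diff: "smooth_fun A f \<Longrightarrow> smooth_fun A h \<Longrightarrow> smooth_fun A (\<lambda>x. f x - h x)"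
  using smooth_fun_add[OF _ smooth_fun_cmult[of h "-1"], of f] by simp

lemma smooth_fun_sum:
  "(\<And>i. i \<in> I \<Longrightarrow> smooth_fun A (f i)) \<Longrightarrow> smooth_fun A (\<lambda>x. \<Sum>i\<in>I. f i x)"
  by (induction I rule: infinite_finite_induct) (auto intro: smooth_fun_const smooth_fun_add)

lemma smooth_fun_prod:
  "(\<And>i. i \<in> I \<Longrightarrow> smooth_fun A (f i)) \<Longrightarrow> smooth_fun A (\<lambda>x. \<Prod>i\<in>I. f i x)"
  by (induction I rule: infinite_finite_induct) (auto intro: smooth_fun_const smooth_fun_mult)

lemma smooth_fun_det:
  fixes a :: "'i::finite \<Rightarrow> 'i \<Rightarrow> 'm \<Rightarrow> real"
  assumes "\<And>i j. smooth_fun A (a i j)"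
  shows "smooth_fun A (\<lambda>x. det (\<chi> i j. a i j x))"
  unfolding det_def by (simp, intro smooth_fun_sum smooth_fun_mult smooth_fun_prod smooth_fun_const assms)

text \<open>
  Smoothness is checked near each point, and there it is enough to write \<open>f\<close> as a quotient of globally
  smooth functions. This is how solutions of linear systems with smooth coefficients are shown to be
  smooth.
\<close>

lemma smooth_fun_quotient_local:
  assumes "\<And>p. \<exists>N d K. open N \<and> p \<in> N \<and> smooth_fun A d \<and> smooth_fun A K \<and>
     (\<forall>q\<in>N. d q \<noteq> 0 \<and> d q * f q = K q)"
  shows "smooth_fun A f"
proof (rule smooth_funI, rule Ck_on_local)
  fix U \<phi> k y assume c: "(U, \<phi>) \<in> A" and y: "y \<in> \<phi> ` U"
  then obtain p where p: "p \<in> U" "y = \<phi> p" by auto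
  obtain N d K where N: "open N" "p \<in> N" "smooth_fun A d" "smooth_fun A K"
    "\<And>q. q \<in> N \<Longrightarrow> d q \<noteq> 0" "\<And>q. q \<in> N \<Longrightarrow> d q * f q = K q"
    using assms[of p] by blast
  let ?T = "\<phi> ` (U \<inter> N)" and ?i = "inv_into U \<phi>"
  have T: "open ?T" by (rule chart_open_image[OF c N(1)])
  have sub: "?T \<subseteq> \<phi> ` U" by auto
  have i: "?i x \<in> N" if "x \<in> ?T" for x using that chart_facts(3)[OF c] by auto
  have Kd: "Ck_on k ?T (\<lambda>x. K (?i x) * inverse (d (?i x)))"
    by (rule Ck_on_mult[OF T Ck_on_subset[OF smooth_fun_Ck[OF N(4) c] sub]
        Ck_on_inverse[OF T N(5)[OF i] Ck_on_subset[OF smooth_fun_Ck[OF N(3) c] sub]]])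
  have "K (?i x) * inverse (d (?i x)) = f (?i x)" if "x \<in> ?T" for x
    using N(5,6)[OF i[OF that]] by (simp add: field_simps)
  then have "Ck_on k ?T (\<lambda>x. f (?i x))" by (rule Ck_on_cong[OF T _ Kd])
  then show "\<exists>T. open T \<and> y \<in> T \<and> Ck_on k T (\<lambda>x. f (?i x))" using T p N(2) by (intro exI[of _ ?T]) auto
qed

text \<open>
  The set \<open>C\<close> pulls back to a compact, hence closed, subset of the Hausdorff space \<open>'m\<close>. So the
  function vanishes on an open set which together with the chart domain covers the manifold.
\<close>

lemma smooth_fun_extend_by_zero:
  assumes c: "(U, \<phi>) \<in> A" and "\<And>k. Ck_on k (\<phi> ` U) \<kappa>"
    and "compact C" "C \<subseteq> \<phi> ` U" and zero: "\<And>y. y \<notin> C \<Longrightarrow> \<kappa> y = 0"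
  shows "smooth_fun A (\<lambda>q. if q \<in> U then \<kappa> (\<phi> q) else 0)" (is "smooth_fun A ?f")
proof (rule smooth_funI, rule Ck_on_local)
  fix V \<psi> k y assume d: "(V, \<psi>) \<in> A" and y: "y \<in> \<psi> ` V"
  let ?i = "inv_into U \<phi>" and ?j = "inv_into V \<psi>"
  obtain q where q: "q \<in> V" "y = \<psi> q" using y by auto
  note c' = chart_facts[OF c] and d' = chart_facts[OF d]
  show "\<exists>T. open T \<and> y \<in> T \<and> Ck_on k T (\<lambda>x. ?f (?j x))"
  proof (cases "q \<in> U")
    case True
    have T: "open (\<psi> ` (V \<inter> U))" by (rule chart_open_image[OF d c'(1)])
    have "Ck_on k (\<psi> ` (V \<inter> U)) (\<lambda>x. \<kappa> ((\<phi> \<circ> ?j) x))"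
      by (rule Ck_on_compose[OF T c'(2) _ assms(2) smooth_on_Ck[OF transition_smooth[OF d c]]])
         (use d'(3) in auto)
    then have "Ck_on k (\<psi> ` (V \<inter> U)) (\<lambda>x. ?f (?j x))"
      by (rule Ck_on_cong[OF T, rotated]) (use d'(3) in auto)
    then show ?thesis using T True q by (intro exI[of _ "\<psi> ` (V \<inter> U)"]) auto
  next
    case False
    define K where "K = ?i ` C"
    have "compact K" unfolding K_def
      using compact_continuous_image continuous_on_subset assms(3,4) c'(5) by metis
    then have T: "open (\<psi> ` (V \<inter> - K))"
      by (intro chart_open_image[OF d] open_Compl compact_imp_closed)
    have KU: "K \<subseteq> U" unfolding K_def using assms(4) c'(3) by auto
    have "Ck_on k (\<psi> ` (V \<inter> - K)) (\<lambda>x. ?f (?j x))"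
    proof (rule Ck_on_cong[OF T _ Ck_on_const[where c = 0]])
      fix x assume "x \<in> \<psi> ` (V \<inter> - K)"
      then have "?j x \<notin> K" using d'(3) by auto
      moreover have "z \<in> K" if "z \<in> U" "\<phi> z \<in> C" for z
        unfolding K_def using that c'(3) by (auto intro!: image_eqI[of _ _ "\<phi> z"])
      ultimately show "0 = ?f (?j x)" using zero by auto
    qed
    then show ?thesis using T q False KU by (intro exI[of _ "\<psi> ` (V \<inter> - K)"]) auto
  qed
qed

lemma tangent_rules:
  assumes "v \<in> tangent_space A p"
  shows "smooth_fun A f \<Longrightarrow> smooth_fun A h \<Longrightarrow> v (\<lambda>x. f x + h x) = v f + v h"
    "smooth_fun A f \<Longrightarrow> smooth_fun A h \<Longrightarrow> v (\<lambda>x. f x * h x) = v f * h p + f p * v h"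
    "smooth_fun A f \<Longrightarrow> v (\<lambda>x. c * f x) = c * v f"
    "\<not> smooth_fun A f \<Longrightarrow> v f = 0"
  using assms unfolding tangent_space_def by blast+

text \<open>
  A derivation kills 1 because \<open>v 1 = v (1 * 1) = 2 * v 1\<close>.
\<close>

lemma tangent_const:
  assumes "v \<in> tangent_space A p" shows "v (\<lambda>x. c) = 0"
proof -
  have "v (\<lambda>x. 1 * 1) = v (\<lambda>x. 1) * 1 + 1 * v (\<lambda>x. 1)"
    by (intro tangent_rules(2)[OF assms] smooth_fun_const)
  then show ?thesis using tangent_rules(3)[OF assms smooth_fun_const[of 1], of c] by simp
qed

lemma tangent_zero: "(\<lambda>f. 0) \<in> tangent_space A p"
  by (simp add: tangent_space_def)

lemma tangent_tadd: "u \<in> tangent_space A p \<Longrightarrow> v \<in> tangent_space A p \<Longrightarrow> tadd u v \<in> tangent_space A p"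
  unfolding tangent_space_def tadd_def by (auto simp: algebra_simps)

lemma tangent_tscale: "u \<in> tangent_space A p \<Longrightarrow> tscale c u \<in> tangent_space A p"
  unfolding tangent_space_def tscale_def by (auto simp: algebra_simps)

lemma tangent_sum:
  assumes "\<And>i. i \<in> I \<Longrightarrow> u i \<in> tangent_space A p"
  shows "(\<lambda>f. \<Sum>i\<in>I. c i * u i f) \<in> tangent_space A p"
  using assms
proof (induction I rule: infinite_finite_induct)
  case (insert x F)
  then have "tadd (tscale (c x) (u x)) (\<lambda>f. \<Sum>i\<in>F. c i * u i f) \<in> tangent_space A p"
    by (intro tangent_tadd tangent_tscale) auto
  then show ?case using insert by (simp add: tadd_def tscale_def)
qed (auto intro: tangent_zero)

lemma field_tangent: "X \<in> vector_fields A \<Longrightarrow> X p \<in> tangent_space A p"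
  by (simp add: vector_fields_def)

lemma field_smooth: "X \<in> vector_fields A \<Longrightarrow> smooth_fun A f \<Longrightarrow> smooth_fun A (\<lambda>p. X p f)"
  by (simp add: vector_fields_def)

lemma field_zero: "(\<lambda>p f. 0) \<in> vector_fields A"
  by (simp add: vector_fields_def tangent_zero smooth_fun_const)

lemma field_fadd: "X \<in> vector_fields A \<Longrightarrow> Y \<in> vector_fields A \<Longrightarrow> fadd X Y \<in> vector_fields A"
  unfolding vector_fields_def fadd_def
  using tangent_tadd smooth_fun_add by (auto simp: tadd_def)

lemma field_fscale: "X \<in> vector_fields A \<Longrightarrow> smooth_fun A f \<Longrightarrow> fscale f X \<in> vector_fields A"
  unfolding vector_fields_def fscale_def
  using tangent_tscale smooth_fun_mult by (auto simp: tscale_def)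

lemma field_sum:
  assumes "\<And>i. i \<in> I \<Longrightarrow> smooth_fun A (c i)" "\<And>i. i \<in> I \<Longrightarrow> X i \<in> vector_fields A"
  shows "(\<lambda>p f. \<Sum>i\<in>I. c i p * X i p f) \<in> vector_fields A"
  using assms unfolding vector_fields_def
  by (auto intro!: tangent_sum smooth_fun_sum smooth_fun_mult)

text \<open>
  The coordinate derivatives \<open>f \<mapsto> D (f \<circ> \<phi>\<^sup>-\<^sup>1) w\<close> times a bump function are global vector fields. They
  are independent wherever the bump function does not vanish: evaluate them on the bump function
  and on its products with the coordinates, which are globally smooth too. That they also span the
  tangent spaces is not derived here from the definition of a derivation; it follows later from a
  dimension count.
\<close>

lemma cut_off_coordinate_fields:
  obtains N :: "'m set" and E :: "'e \<Rightarrow> 'm field" where "open N" "p \<in> N"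
    "\<And>w. E w \<in> vector_fields A"
    "\<And>w q. q \<notin> N \<Longrightarrow> E w q = (\<lambda>f. 0)"
    "\<And>q f. linear (\<lambda>w. E w q f)"
    "\<And>w q. q \<in> N \<Longrightarrow> E w q = (\<lambda>f. 0) \<Longrightarrow> w = 0"
proof -
  obtain U \<phi> where c: "(U, \<phi>) \<in> A" and pU: "p \<in> U" using chart_around by blast
  note c' = chart_facts[OF c]
  let ?i = "inv_into U \<phi>"
  have i: "?i (\<phi> q) = q" if "q \<in> U" for q using c'(3) that by simp
  obtain r where r: "r > 0" "cball (\<phi> p) r \<subseteq> \<phi> ` U"
    using c'(2) pU open_contains_cball by blast
  \<comment> \<open>a bump function in the chart, positive exactly on the ball of radius \<open>r\<close>\<close>
  define k where "k y = flat 0 (r\<^sup>2 - (dist (\<phi> p) y)\<^sup>2)" for y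
  have Ck: "Ck_on j (\<phi> ` U) k" for j
    unfolding k_def by (rule Ck_on_subset[OF Ck_on_ball_bump]) simp
  have k_pos: "k y \<noteq> 0 \<longleftrightarrow> dist (\<phi> p) y < r" for y
    using r(1) by (auto simp: k_def flat_def abs_le_square_iff power_mono power_strict_mono not_less dest: power_less_imp_less_base)
  have k_0: "k y = 0" if "\<not> dist (\<phi> p) y \<le> r" for y using k_pos[of y] that by linarith
  define N where "N = {q \<in> U. k (\<phi> q) \<noteq> 0}"
  have ext: "smooth_fun A (\<lambda>q. if q \<in> U then k (\<phi> q) * \<mu> (\<phi> q) else 0)"
    if "\<And>j. Ck_on j (\<phi> ` U) \<mu>" for \<mu>
    by (rule smooth_fun_extend_by_zero[OF c, where \<kappa> = "\<lambda>y. k y * \<mu> y" and C = "cball (\<phi> p) r"])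
       (use r that in \<open>auto intro: Ck_on_mult Ck c' simp: k_0\<close>)
  define D where "D f q = frechet_derivative (\<lambda>y. f (?i y)) (at (\<phi> q))" for f :: "'m \<Rightarrow> real" and q
  have hasD: "((\<lambda>y. f (?i y)) has_derivative D f q) (at (\<phi> q))" if "smooth_fun A f" "q \<in> U" for f q
    using smooth_fun_Ck[OF that(1) c, of 1] that(2) c'(2)
    by (auto simp: D_def frechet_derivative_works[symmetric] differentiable_on_eq_differentiable_at)
  have D_eq: "D f q = d" if "((\<lambda>y. f (?i y)) has_derivative d) (at (\<phi> q))" for f q d
    unfolding D_def using frechet_derivative_at[OF that] by simp
  have D_lin: "linear (D f q)" if "smooth_fun A f" "q \<in> U" for f q
    using hasD[OF that] has_derivative_linear by blast
  \<comment> \<open>tangent vectors are 0 on functions that are not smooth\<close>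
  define E where "E w q f = (if smooth_fun A f \<and> q \<in> U then k (\<phi> q) * D f q w else 0)" for w q f
  have D_add: "D (\<lambda>x. f x + h x) q w = D f q w + D h q w"
    if "smooth_fun A f" "smooth_fun A h" "q \<in> U" for f h q w
    using D_eq[OF has_derivative_add[OF hasD[OF that(1,3)] hasD[OF that(2,3)]]] by simp
  have D_mult: "D (\<lambda>x. f x * h x) q w = D f q w * h q + f q * D h q w"
    if "smooth_fun A f" "smooth_fun A h" "q \<in> U" for f h q w
    using D_eq[OF has_derivative_mult[OF hasD[OF that(1,3)] hasD[OF that(2,3)]]] i[OF that(3)] by simp
  have D_const: "D (\<lambda>x. a) q w = 0" for a q w
    using D_eq[OF has_derivative_const[of a]] by simp
  show ?thesis
  proof
    have "N = (k \<circ> \<phi>) -` (- {0}) \<inter> U" by (auto simp: N_def)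
    moreover have "continuous_on U (k \<circ> \<phi>)"
      using c'(4) Ck[of 0] by (intro continuous_on_compose) auto
    ultimately show "open N"
      using continuous_on_open_vimage[OF c'(1)] by (metis open_Compl closed_singleton)
    show "p \<in> N" using pU r by (simp add: N_def k_pos)
    show "E w q = (\<lambda>f. 0)" if "q \<notin> N" for w q using that by (auto simp: E_def N_def)
    show "linear (\<lambda>w. E w q f)" for q f
    proof (cases "smooth_fun A f \<and> q \<in> U")
      case True
      then show ?thesis
        using D_lin[of f q] by (simp add: E_def linear_iff algebra_simps)
    qed (auto simp: E_def linear_iff)
    show "E w \<in> vector_fields A" for w
      unfolding vector_fields_def
    proof (intro CollectI conjI allI impI)
      fix q
      show "E w q \<in> tangent_space A q"
        unfolding tangent_space_def E_def
        by (auto simp: smooth_fun_add smooth_fun_mult smooth_fun_const D_add D_mult D_const algebra_simps)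
    next
      fix f assume f: "smooth_fun A f"
      show "smooth_fun A (\<lambda>q. E w q f)"
        using ext[of "\<lambda>y. frechet_derivative (\<lambda>y. f (?i y)) (at y) w"] smooth_fun_Ck[OF f c, of "Suc _"]
        by (simp add: E_def D_def f cong: if_cong)
    qed
    show "w = 0" if q: "q \<in> N" and zero: "E w q = (\<lambda>f. 0)" for w q
    proof -
      have qU: "q \<in> U" and kq: "k (\<phi> q) \<noteq> 0" using q by (auto simp: N_def)
      have Dw: "D f q w = 0" if "smooth_fun A f" for f
        using fun_cong[OF zero, of f] that qU kq by (simp add: E_def)
      let ?h = "\<lambda>q. if q \<in> U then k (\<phi> q) else 0"
      have "w \<bullet> b = 0" for b
      proof -
        let ?x = "\<lambda>q. if q \<in> U then k (\<phi> q) * (\<phi> q \<bullet> b) else 0"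
        have h: "smooth_fun A ?h" using ext[of "\<lambda>_. 1"] by (simp add: Ck_on_const cong: if_cong)
        have x: "smooth_fun A ?x"
          using ext[of "\<lambda>y. y \<bullet> b"] by (simp add: Ck_on_bounded_linear bounded_linear_inner_left c')
        have "((\<lambda>y. ?h (?i y) * (y \<bullet> b)) has_derivative
            (\<lambda>w. ?h (?i (\<phi> q)) * (w \<bullet> b) + D ?h q w * (\<phi> q \<bullet> b))) (at (\<phi> q))"
          by (intro has_derivative_mult hasD[OF h qU] bounded_linear_imp_has_derivative bounded_linear_inner_left)
        then have "((\<lambda>y. ?x (?i y)) has_derivative
            (\<lambda>w. ?h (?i (\<phi> q)) * (w \<bullet> b) + D ?h q w * (\<phi> q \<bullet> b))) (at (\<phi> q))"
          by (rule has_derivative_transform_within_open[OF _ c'(2)])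
             (use qU in \<open>auto simp: i\<close>)
        from fun_cong[OF D_eq[OF this], of w] show ?thesis
          using Dw[OF x] Dw[OF h] qU kq by (simp add: i)
      qed
      then show ?thesis by (metis inner_eq_zero_iff)
    qed
  qed
qed

end

section \<open>Frames and the representation of linear functionals\<close>

text \<open>
  Determinants need a finite type of indices; the elements of \<open>Basis\<close> are made into one.
\<close>

typedef (overloaded) 'a basis_index = "Basis :: 'a::euclidean_space set"
  using nonempty_Basis by blast

lemma bij_Rep_basis_index: "bij_betw Rep_basis_index UNIV (Basis :: 'a::euclidean_space set)"
  using type_definition.Rep_range[OF type_definition_basis_index] Rep_basis_index_inject
  by (auto simp: bij_betw_def inj_def)

instance basis_index :: (euclidean_space) finite
proof
  show "finite (UNIV :: 'a basis_index set)"
    using bij_betw_finite[OF bij_Rep_basis_index] finite_Basis by blast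
qed

locale metric_manifold = smooth_manifold A
  for A :: "('m::{t2_space, second_countable_topology}, 'e::euclidean_space) chart set" +
  fixes g :: "'m bilinear_form" and r s :: nat
  assumes metric: "pseudo_riemannian_metric A g"
    and signature: "has_signature A g r s" "r + s = DIM('e)"
begin

lemma metric_rules:
  assumes h: "pseudo_riemannian_metric A h" and "u \<in> tangent_space A p" "v \<in> tangent_space A p"
  shows "h p u v = h p v u" "h p (tscale c u) v = c * h p u v" "h p u (tscale c v) = c * h p u v"
    "w \<in> tangent_space A p \<Longrightarrow> h p (tadd u w) v = h p u v + h p w v"
    "w \<in> tangent_space A p \<Longrightarrow> h p u (tadd v w) = h p u v + h p u w"
proof -
  have sym: "h p u v = h p v u" if "u \<in> tangent_space A p" "v \<in> tangent_space A p" for u v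
    using h that unfolding pseudo_riemannian_metric_def by blast
  have sc: "h p (tscale c u) v = c * h p u v" if "u \<in> tangent_space A p" "v \<in> tangent_space A p" for u v
    using h that unfolding pseudo_riemannian_metric_def by blast
  have ad: "h p (tadd u w) v = h p u v + h p w v"
    if "u \<in> tangent_space A p" "v \<in> tangent_space A p" "w \<in> tangent_space A p" for u v w
    using h that unfolding pseudo_riemannian_metric_def by blast
  show "h p u v = h p v u" "h p (tscale c u) v = c * h p u v"
    using sym sc assms by blast+
  show "h p u (tscale c v) = c * h p u v"
    using sym[of u "tscale c v"] sym[of u v] sc[of v u] assms tangent_tscale by simp
  show "h p (tadd u w) v = h p u v + h p w v" if "w \<in> tangent_space A p" using ad assms that by blast
  show "h p u (tadd v w) = h p u v + h p u w" if "w \<in> tangent_space A p"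
    using sym[of u "tadd v w"] sym[of u v] sym[of u w] ad[of v u w] assms that tangent_tadd by simp
qed

lemma metric_nondegenerate:
  assumes "pseudo_riemannian_metric A h" "u \<in> tangent_space A p"
    "\<And>v. v \<in> tangent_space A p \<Longrightarrow> h p u v = 0"
  shows "u = (\<lambda>f. 0)"
  using assms unfolding pseudo_riemannian_metric_def by blast

lemma metric_smooth:
  "pseudo_riemannian_metric A h \<Longrightarrow> X \<in> vector_fields A \<Longrightarrow> Y \<in> vector_fields A \<Longrightarrow>
    smooth_fun A (\<lambda>p. h p (X p) (Y p))"
  unfolding pseudo_riemannian_metric_def by blast

lemma metric_zero:
  assumes "v \<in> tangent_space A p" shows "g p (\<lambda>f. 0) v = 0" "g p v (\<lambda>f. 0) = 0"
  using metric_rules(2,3)[OF metric tangent_zero[of p] assms, of 0]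
    metric_rules(3)[OF metric assms tangent_zero[of p], of 0] by (simp_all add: tscale_def)

lemma metric_sum:
  assumes "\<And>i. i \<in> I \<Longrightarrow> u i \<in> tangent_space A p" "v \<in> tangent_space A p"
  shows "g p (\<lambda>f. \<Sum>i\<in>I. c i * u i f) v = (\<Sum>i\<in>I. c i * g p (u i) v)"
  using assms(1)
proof (induction I rule: infinite_finite_induct)
  case (insert x F)
  have "g p (tadd (tscale (c x) (u x)) (\<lambda>f. \<Sum>i\<in>F. c i * u i f)) v
      = g p (tscale (c x) (u x)) v + g p (\<lambda>f. \<Sum>i\<in>F. c i * u i f) v"
    using insert.prems assms(2)
    by (intro metric_rules(4)[OF metric tangent_tscale _ tangent_sum]) auto
  also have "\<dots> = c x * g p (u x) v + (\<Sum>i\<in>F. c i * g p (u i) v)"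
    using insert assms(2) by (simp add: metric_rules(2)[OF metric])
  finally show ?case using insert.hyps by (simp add: tadd_def tscale_def)
qed (simp_all add: metric_zero assms)

lemma metric_sum_right:
  assumes "\<And>i. i \<in> I \<Longrightarrow> u i \<in> tangent_space A p" "v \<in> tangent_space A p"
  shows "g p v (\<lambda>f. \<Sum>i\<in>I. c i * u i f) = (\<Sum>i\<in>I. c i * g p v (u i))"
proof -
  have "g p v (\<lambda>f. \<Sum>i\<in>I. c i * u i f) = g p (\<lambda>f. \<Sum>i\<in>I. c i * u i f) v"
    by (rule metric_rules(1)[OF metric assms(2) tangent_sum[OF assms(1)]])
  also have "\<dots> = (\<Sum>i\<in>I. c i * g p v (u i))"
    by (subst metric_sum[OF assms], assumption, intro sum.cong refl) (simp add: metric_rules(1)[OF metric assms(2) assms(1)])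
  finally show ?thesis .
qed

text \<open>
  The number \<open>\<epsilon> i\<close> is the square of \<open>e i\<close>, which is 1 or -1, hence its own inverse.
\<close>

lemma orthonormal_expansion:
  obtains e :: "nat \<Rightarrow> 'm tangent" and \<epsilon> :: "nat \<Rightarrow> real"
  where "\<And>i. i < DIM('e) \<Longrightarrow> e i \<in> tangent_space A p"
    "\<And>u. u \<in> tangent_space A p \<Longrightarrow> u = (\<lambda>f. \<Sum>i<DIM('e). (\<epsilon> i * g p u (e i)) * e i f)"
proof -
  obtain e where e: "\<And>i. i < DIM('e) \<Longrightarrow> e i \<in> tangent_space A p"
    and span: "\<And>v. v \<in> tangent_space A p \<Longrightarrow> \<exists>c. v = (\<lambda>f. \<Sum>i<DIM('e). c i * e i f)"
    and orth: "\<And>i j. i < DIM('e) \<Longrightarrow> j < DIM('e) \<Longrightarrow>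
       g p (e i) (e j) = (if i \<noteq> j then 0 else if i < r then 1 else -1)"
    using signature(1)[unfolded has_signature_def, rule_format, of p] unfolding signature(2) by blast
  define \<epsilon> :: "nat \<Rightarrow> real" where "\<epsilon> i = (if i < r then 1 else -1)" for i
  show ?thesis
  proof (rule that[of e \<epsilon>])
    fix u assume "u \<in> tangent_space A p"
    then obtain c where c: "u = (\<lambda>f. \<Sum>i<DIM('e). c i * e i f)" using span by blast
    have "\<epsilon> i * g p u (e i) = c i" if i: "i < DIM('e)" for i
    proof -
      have "g p u (e i) = (\<Sum>j<DIM('e). c j * g p (e j) (e i))"
        unfolding c by (rule metric_sum) (use e i in auto)
      also have "\<dots> = (\<Sum>j<DIM('e). if j = i then c i * \<epsilon> i else 0)"
        by (rule sum.cong) (use orth i in \<open>auto simp: \<epsilon>_def\<close>)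
      also have "\<dots> = c i * \<epsilon> i" using i by simp
      finally show ?thesis by (simp add: \<epsilon>_def)
    qed
    then show "u = (\<lambda>f. \<Sum>i<DIM('e). (\<epsilon> i * g p u (e i)) * e i f)"
      using c by simp
  qed (use e in auto)
qed

text \<open>
  Taking products with an orthonormal basis turns \<open>T\<close> into an injective endomorphism of \<open>'e\<close>,
  which is then surjective. Here the signature hypothesis is essential: it says that tangent
  spaces, defined as spaces of derivations, have the dimension of the model space.
\<close>

lemma injective_imp_onto_tangent_space:
  fixes T :: "'e \<Rightarrow> 'm tangent"
  assumes T: "\<And>w. T w \<in> tangent_space A p" and lin: "\<And>f. linear (\<lambda>w. T w f)"
    and inj: "\<And>w. T w = (\<lambda>f. 0) \<Longrightarrow> w = 0" and v: "v \<in> tangent_space A p"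
  obtains w where "v = T w"
proof -
  obtain e :: "nat \<Rightarrow> 'm tangent" and \<epsilon> where e: "\<And>i. i < DIM('e) \<Longrightarrow> e i \<in> tangent_space A p"
    and expand: "\<And>u. u \<in> tangent_space A p \<Longrightarrow> u = (\<lambda>f. \<Sum>i<DIM('e). (\<epsilon> i * g p u (e i)) * e i f)"
    by (rule orthonormal_expansion[of p]) (rule that)
  obtain \<beta> where \<beta>: "bij_betw \<beta> (Basis :: 'e set) {..<DIM('e)}"
    using ex_bij_betw_finite_nat[OF finite_Basis] by (auto simp: lessThan_atLeast0)
  have \<beta>_lt: "\<beta> b < DIM('e)" if "b \<in> Basis" for b using bij_betwE[OF \<beta>] that by auto
  define L :: "'m tangent \<Rightarrow> 'e" where "L u = (\<Sum>b\<in>Basis. g p u (e (\<beta> b)) *\<^sub>R b)" for u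
  have L_inj: "u = u'" if "u \<in> tangent_space A p" "u' \<in> tangent_space A p" "L u = L u'" for u u'
  proof -
    have "g p u (e i) = g p u' (e i)" if i: "i < DIM('e)" for i
    proof -
      obtain b where "b \<in> Basis" "i = \<beta> b" using \<beta> i by (auto simp: bij_betw_def)
      then show ?thesis
        using arg_cong[OF \<open>L u = L u'\<close>, of "\<lambda>x. x \<bullet> b"] by (simp add: L_def)
    qed
    then show ?thesis using expand[OF that(1)] expand[OF that(2)] by simp
  qed
  have T_add: "T (w + w') = tadd (T w) (T w')" for w w'
    by (rule ext) (simp add: tadd_def linear_add[OF lin])
  have T_scale: "T (c *\<^sub>R w) = tscale c (T w)" for c w
    by (rule ext) (simp add: tscale_def linear_cmul[OF lin])
  have L_lin: "linear (\<lambda>w. L (T w))"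
  proof (rule linearI)
    show "L (T (w + w')) = L (T w) + L (T w')" for w w'
      by (simp add: L_def T_add sum.distrib[symmetric] scaleR_left_distrib[symmetric]
          metric_rules(4)[OF metric] T e \<beta>_lt)
    show "L (T (c *\<^sub>R w)) = c *\<^sub>R L (T w)" for c w
      by (simp add: L_def T_scale scaleR_sum_right metric_rules(2)[OF metric] T e \<beta>_lt)
  qed
  have "inj (\<lambda>w. L (T w))"
  proof (subst linear_injective_0[OF L_lin], intro allI impI)
    fix w assume "L (T w) = 0"
    moreover have "T 0 = (\<lambda>f. 0)" using linear_0[OF lin] by auto
    moreover have "L (\<lambda>f. 0) = 0" by (simp add: L_def metric_zero e \<beta>_lt)
    ultimately have "T w = T 0" using L_inj[OF T T, of w 0] by simp
    with \<open>T 0 = (\<lambda>f. 0)\<close> show "w = 0" using inj by simp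
  qed
  then have "surj (\<lambda>w. L (T w))" using linear_injective_imp_surjective[OF L_lin] by simp
  then obtain w where "L v = L (T w)" by (auto elim: surjE)
  then show ?thesis using that[of w] L_inj[OF v T[of w]] by simp
qed

lemma field_through_vector:
  assumes "v \<in> tangent_space A p"
  obtains X where "X \<in> vector_fields A" "X p = v"
proof -
  obtain N and E :: "'e \<Rightarrow> 'm field" where E: "p \<in> N" "\<And>w. E w \<in> vector_fields A"
    "\<And>q f. linear (\<lambda>w. E w q f)" "\<And>w q. q \<in> N \<Longrightarrow> E w q = (\<lambda>f. 0) \<Longrightarrow> w = 0"
    using cut_off_coordinate_fields[of p] by metis
  obtain w where "v = E w p"
    by (rule injective_imp_onto_tangent_space[of "\<lambda>w. E w p" p v])
       (use E assms field_tangent in auto)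
  then show ?thesis using that E by blast
qed

text \<open>
  \<open>cramer_det E \<beta> i\<close> is the numerator in Cramer's rule for the \<open>i\<close>-th unknown of the linear system
  with matrix \<open>gram E\<close> and right hand side \<open>\<beta>\<close>.
\<close>

definition gram :: "('i::finite \<Rightarrow> 'm field) \<Rightarrow> 'm \<Rightarrow> real^'i^'i" where
  "gram E q = (\<chi> k l. g q (E k q) (E l q))"

definition cramer_det :: "('i::finite \<Rightarrow> 'm field) \<Rightarrow> ('i \<Rightarrow> real) \<Rightarrow> 'i \<Rightarrow> 'm \<Rightarrow> real" where
  "cramer_det E \<beta> i q = det (\<chi> k l. if l = i then \<beta> k else gram E q $ k $ l)"

lemma smooth_fun_det_gram:
  "(\<And>i. E i \<in> vector_fields A) \<Longrightarrow> smooth_fun A (\<lambda>q. det (gram E q))"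
  unfolding gram_def by (intro smooth_fun_det metric_smooth[OF metric])

lemma smooth_fun_cramer_det:
  assumes "\<And>i. E i \<in> vector_fields A" "\<And>k. smooth_fun A (\<beta> k)"
  shows "smooth_fun A (\<lambda>q. cramer_det E (\<lambda>k. \<beta> k q) i q)"
proof -
  have "smooth_fun A (\<lambda>q. if l = i then \<beta> k q else gram E q $ k $ l)" for k l
    by (cases "l = i") (simp_all add: gram_def metric_smooth[OF metric] assms)
  then show ?thesis unfolding cramer_det_def by (rule smooth_fun_det)
qed

text \<open>
  Cramer's rule with the denominator cleared. As the fields \<open>E i\<close> vanish outside \<open>N\<close>, both sides are
  0 there, so that the expansion holds on the whole manifold with globally smooth coefficients. It
  can therefore be inserted into a functional that is defined on global vector fields only.
\<close>

lemma cramer_frame: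
  obtains N and E :: "'e basis_index \<Rightarrow> 'm field" where "open N" "p \<in> N" "\<And>i. E i \<in> vector_fields A"
    "\<And>q. q \<in> N \<Longrightarrow> det (gram E q) \<noteq> 0"
    "\<And>q v f. v \<in> tangent_space A q \<Longrightarrow>
       det (gram E q) * v f = (\<Sum>i\<in>UNIV. cramer_det E (\<lambda>k. g q (E k q) v) i q * E i q f)"
proof -
  obtain N and T :: "'e \<Rightarrow> 'm field" where N: "open N" "p \<in> N" and T: "\<And>w. T w \<in> vector_fields A"
    and out: "\<And>w q. q \<notin> N \<Longrightarrow> T w q = (\<lambda>f. 0)"
    and lin: "\<And>q f. linear (\<lambda>w. T w q f)"
    and inj: "\<And>w q. q \<in> N \<Longrightarrow> T w q = (\<lambda>f. 0) \<Longrightarrow> w = 0"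
    using cut_off_coordinate_fields[of p] by metis
  define E where "E i = T (Rep_basis_index i)" for i :: "'e basis_index"
  have E: "E i \<in> vector_fields A" for i by (simp add: E_def T)
  note Et = field_tangent[OF E]
  have T_eq: "T w q = (\<lambda>f. \<Sum>i\<in>UNIV. (w \<bullet> Rep_basis_index i) * E i q f)" for w q
  proof
    fix f
    have "T w q f = T (\<Sum>b\<in>Basis. (w \<bullet> b) *\<^sub>R b) q f" by (simp add: euclidean_representation)
    also have "\<dots> = (\<Sum>b\<in>Basis. (w \<bullet> b) * T b q f)"
      by (simp add: linear_sum[OF lin] linear_cmul[OF lin])
    also have "\<dots> = (\<Sum>i\<in>UNIV. (w \<bullet> Rep_basis_index i) * E i q f)"
      unfolding E_def by (rule sum.reindex_bij_betw[OF bij_Rep_basis_index, symmetric])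
    finally show "T w q f = (\<Sum>i\<in>UNIV. (w \<bullet> Rep_basis_index i) * E i q f)" .
  qed
  have span: "\<exists>x. v = (\<lambda>f. \<Sum>i\<in>UNIV. x i * E i q f)" if qN: "q \<in> N" and vT: "v \<in> tangent_space A q" for q v
  proof -
    obtain w where "v = T w q"
      by (rule injective_imp_onto_tangent_space[of "\<lambda>w. T w q" q v])
         (use inj[OF qN] vT lin field_tangent[OF T] in auto)
    then show ?thesis unfolding T_eq by (rule exI[of _ "\<lambda>i. w \<bullet> Rep_basis_index i"])
  qed
  have indep: "x i = 0" if q: "q \<in> N" and x: "(\<lambda>f. \<Sum>i\<in>UNIV. x i * E i q f) = (\<lambda>f. 0)" for x q i
  proof -
    define w where "w = (\<Sum>i\<in>UNIV. x i *\<^sub>R Rep_basis_index i :: 'e)"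
    have "T w q = (\<lambda>f. 0)"
      using x by (simp add: w_def linear_sum[OF lin] linear_cmul[OF lin] E_def fun_eq_iff)
    then have "w = 0" using inj q by blast
    have "0 = w \<bullet> Rep_basis_index i" using \<open>w = 0\<close> by simp
    also have "\<dots> = (\<Sum>j\<in>UNIV. if j = i then x i else 0)"
      unfolding w_def inner_sum_left
      by (rule sum.cong) (auto simp: inner_Basis Rep_basis_index Rep_basis_index_inject)
    finally show ?thesis by simp
  qed
  \<comment> \<open>the Gram matrix applied to coordinates gives the products with the frame\<close>
  have gram_mult: "(gram E q *v x) $ k = g q (E k q) (\<lambda>f. \<Sum>i\<in>UNIV. x $ i * E i q f)" for q x k
    unfolding matrix_vector_mult_def gram_def
    by (subst metric_sum_right) (auto intro: Et simp: mult.commute)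
  have det: "det (gram E q) \<noteq> 0" if q: "q \<in> N" for q
  proof -
    have "x = 0" if x: "gram E q *v x = 0" for x
    proof -
      let ?u = "\<lambda>f. \<Sum>i\<in>UNIV. x $ i * E i q f"
      have u: "?u \<in> tangent_space A q" by (intro tangent_sum Et)
      have "?u = (\<lambda>f. 0)"
      proof (rule metric_nondegenerate[OF metric u])
        fix v assume "v \<in> tangent_space A q"
        then obtain y where y: "v = (\<lambda>f. \<Sum>i\<in>UNIV. y i * E i q f)" using span q by blast
        have "g q ?u v = (\<Sum>k\<in>UNIV. y k * g q ?u (E k q))"
          unfolding y by (intro metric_sum_right Et u)
        also have "\<dots> = (\<Sum>k\<in>UNIV. y k * (gram E q *v x) $ k)"
          unfolding gram_mult metric_rules(1)[OF metric u Et] ..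
        finally show "g q ?u v = 0" using x by simp
      qed
      then show "x = 0" using indep[OF q, of "\<lambda>i. x $ i"] by (simp add: vec_eq_iff)
    qed
    then have "\<exists>B. B ** gram E q = mat 1" using matrix_left_invertible_ker by blast
    then show ?thesis using invertible_det_nz invertible_left_inverse by blast
  qed
  show ?thesis
  proof (rule that[OF N E])
    show "det (gram E q) \<noteq> 0" if "q \<in> N" for q by (rule det[OF that])
    fix q v f assume v: "v \<in> tangent_space A q"
    show "det (gram E q) * v f = (\<Sum>i\<in>UNIV. cramer_det E (\<lambda>k. g q (E k q) v) i q * E i q f)"
    proof (cases "q \<in> N")
      case True
      then obtain x where x: "v = (\<lambda>f. \<Sum>i\<in>UNIV. x i * E i q f)" using span v by blast
      have vx: "(\<lambda>f. \<Sum>i\<in>UNIV. (\<chi> i. x i) $ i * E i q f) = v" by (simp add: x)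
      have "cramer_det E (\<lambda>k. g q (E k q) v) i q = x i * det (gram E q)" for i
        using cramer_lemma[of i "gram E q" "\<chi> i. x i"] unfolding gram_mult vx
        by (simp add: cramer_det_def)
      then show ?thesis
        using fun_cong[OF x, of f] by (simp add: sum_distrib_left mult_ac)
    next
      case False
      then have "E k q = (\<lambda>f. 0)" for k by (simp add: E_def out)
      then have "gram E q = mat 0" by (simp add: gram_def mat_def metric_zero tangent_zero vec_eq_iff)
      then have "det (gram E q) = 0" by (simp only: det_0)
      then show ?thesis using False by (simp add: E_def out)
    qed
  qed
qed

lemma functional_sum:
  fixes F :: "'m field \<Rightarrow> 'm \<Rightarrow> real"
  assumes add: "\<And>X Y p. X \<in> vector_fields A \<Longrightarrow> Y \<in> vector_fields A \<Longrightarrow> F (fadd X Y) p = F X p + F Y p"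
    and scale: "\<And>f X p. smooth_fun A f \<Longrightarrow> X \<in> vector_fields A \<Longrightarrow> F (fscale f X) p = f p * F X p"
    and "\<And>i. i \<in> I \<Longrightarrow> smooth_fun A (c i)" "\<And>i. i \<in> I \<Longrightarrow> X i \<in> vector_fields A"
  shows "F (\<lambda>q f. \<Sum>i\<in>I. c i q * X i q f) p = (\<Sum>i\<in>I. c i p * F (X i) p)"
  using assms(3,4)
proof (induction I rule: infinite_finite_induct)
  case (insert x I)
  have "(\<lambda>q f. \<Sum>i\<in>insert x I. c i q * X i q f) = fadd (fscale (c x) (X x)) (\<lambda>q f. \<Sum>i\<in>I. c i q * X i q f)"
    using insert.hyps by (simp add: fadd_def fscale_def tadd_def tscale_def)
  then show ?case
    using insert by (simp add: add scale field_fscale field_sum)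
next
  case empty
  have "F (\<lambda>q f. 0) p = F (fscale (\<lambda>_. 0) (\<lambda>q f. 0)) p" by (simp add: fscale_def tscale_def)
  then show ?case using scale[OF smooth_fun_const[of 0] field_zero] by simp
next
  case (infinite I)
  have "F (\<lambda>q f. 0) p = F (fscale (\<lambda>_. 0) (\<lambda>q f. 0)) p" by (simp add: fscale_def tscale_def)
  then show ?case using infinite.hyps scale[OF smooth_fun_const[of 0] field_zero] by simp
qed

text \<open>
  Multiplied with the Gram determinant, \<open>X\<close> is a combination of frame fields whose coefficients at
  \<open>p\<close> depend on \<open>X p\<close> only, and \<open>F\<close> is linear over the smooth functions.
\<close>

lemma functional_pointwise:
  fixes F :: "'m field \<Rightarrow> 'm \<Rightarrow> real"
  assumes add: "\<And>X Y p. X \<in> vector_fields A \<Longrightarrow> Y \<in> vector_fields A \<Longrightarrow> F (fadd X Y) p = F X p + F Y p"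
    and scale: "\<And>f X p. smooth_fun A f \<Longrightarrow> X \<in> vector_fields A \<Longrightarrow> F (fscale f X) p = f p * F X p"
    and X: "X \<in> vector_fields A" and Y: "Y \<in> vector_fields A" and eq: "X p = Y p"
  shows "F X p = F Y p"
proof -
  obtain N and E :: "'e basis_index \<Rightarrow> 'm field" where "open N" and p: "p \<in> N" and E: "\<And>i. E i \<in> vector_fields A"
    and nz: "\<And>q. q \<in> N \<Longrightarrow> det (gram E q) \<noteq> 0"
    and expand: "\<And>q v f. v \<in> tangent_space A q \<Longrightarrow> det (gram E q) * v f =
        (\<Sum>i\<in>UNIV. cramer_det E (\<lambda>k. g q (E k q) v) i q * E i q f)"
    by (rule cramer_frame[of p]) (rule that)
  define C where "C v i q = cramer_det E (\<lambda>k. g q (E k q) v) i q" for v i q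
  note d = smooth_fun_det_gram[of E, OF E]
  have "det (gram E p) * F X p = (\<Sum>i\<in>UNIV. C (X p) i p * F (E i) p)" if X: "X \<in> vector_fields A" for X
  proof -
    have C: "smooth_fun A (\<lambda>q. C (X q) i q)" for i
      unfolding C_def
      by (rule smooth_fun_cramer_det[of E "\<lambda>k q. g q (E k q) (X q)", OF E metric_smooth[OF metric E X]])
    have "fscale (\<lambda>q. det (gram E q)) X = (\<lambda>q f. \<Sum>i\<in>UNIV. C (X q) i q * E i q f)"
      unfolding fscale_def tscale_def C_def expand[OF field_tangent[OF X]] ..
    then have "det (gram E p) * F X p = F (\<lambda>q f. \<Sum>i\<in>UNIV. C (X q) i q * E i q f) p"
      using scale[OF d X] by simp
    also have "\<dots> = (\<Sum>i\<in>UNIV. C (X p) i p * F (E i) p)"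
      using functional_sum[of F UNIV "\<lambda>i q. C (X q) i q" E p] add scale C E by blast
    finally show ?thesis .
  qed
  from this[OF X] this[OF Y] have "det (gram E p) * F X p = det (gram E p) * F Y p" by (simp add: eq)
  then show ?thesis using nz[OF p] by simp
qed

text \<open>
  Nondegeneracy gives a representing vector at each point. The resulting field is smooth because its
  coordinates with respect to a local frame solve a linear system whose matrix, the Gram matrix of
  the frame, and whose right hand side, the values of \<open>F\<close> on the frame, are smooth.
\<close>

lemma functional_representation:
  fixes F :: "'m field \<Rightarrow> 'm \<Rightarrow> real"
  assumes add: "\<And>X Y p. X \<in> vector_fields A \<Longrightarrow> Y \<in> vector_fields A \<Longrightarrow> F (fadd X Y) p = F X p + F Y p"
    and scale: "\<And>f X p. smooth_fun A f \<Longrightarrow> X \<in> vector_fields A \<Longrightarrow> F (fscale f X) p = f p * F X p"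
    and smooth: "\<And>X. X \<in> vector_fields A \<Longrightarrow> smooth_fun A (F X)"
  shows "\<exists>W\<in>vector_fields A. \<forall>X\<in>vector_fields A. \<forall>p. g p (X p) (W p) = F X p"
proof -
  \<comment> \<open>the vector with the prescribed products with an orthonormal basis, the values of \<open>F\<close> being
      read off on fields that extend the basis vectors\<close>
  have "\<exists>w\<in>tangent_space A p. \<forall>X\<in>vector_fields A. g p (X p) w = F X p" for p
  proof -
    obtain e :: "nat \<Rightarrow> 'm tangent" and \<epsilon> where e: "\<And>i. i < DIM('e) \<Longrightarrow> e i \<in> tangent_space A p"
      and expand: "\<And>u. u \<in> tangent_space A p \<Longrightarrow> u = (\<lambda>f. \<Sum>i<DIM('e). (\<epsilon> i * g p u (e i)) * e i f)"
      by (rule orthonormal_expansion[of p]) (rule that)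
    have "\<forall>i. \<exists>X. i < DIM('e) \<longrightarrow> X \<in> vector_fields A \<and> X p = e i"
      using field_through_vector[OF e] by metis
    then obtain X where X: "\<And>i. i < DIM('e) \<Longrightarrow> X i \<in> vector_fields A" "\<And>i. i < DIM('e) \<Longrightarrow> X i p = e i"
      by metis
    define w where "w = (\<lambda>f. \<Sum>i<DIM('e). (\<epsilon> i * F (X i) p) * e i f)"
    have w: "w \<in> tangent_space A p" unfolding w_def by (intro tangent_sum) (simp add: e)
    have "g p (Y p) w = F Y p" if Y: "Y \<in> vector_fields A" for Y
    proof -
      let ?c = "\<lambda>i. \<epsilon> i * g p (Y p) (e i)"
      \<comment> \<open>this field agrees with \<open>Y\<close> at \<open>p\<close>, where its coefficients, constants, were computed\<close>
      let ?Y = "\<lambda>q f. \<Sum>i<DIM('e). ?c i * X i q f"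
      have Y': "?Y \<in> vector_fields A"
        using field_sum[of "{..<DIM('e)}" "\<lambda>i _. ?c i" X] X smooth_fun_const by simp
      have "Y p = ?Y p" using expand[OF field_tangent[OF Y]] X by simp
      then have "F Y p = F ?Y p"
        using functional_pointwise[of F Y ?Y p] add scale Y Y' by blast
      also have "\<dots> = (\<Sum>i<DIM('e). ?c i * F (X i) p)"
        using functional_sum[of F "{..<DIM('e)}" "\<lambda>i _. ?c i" X p] add scale X smooth_fun_const by simp
      also have "\<dots> = g p (Y p) w"
        unfolding w_def by (subst metric_sum_right) (auto simp: e field_tangent Y mult_ac)
      finally show ?thesis by simp
    qed
    then show ?thesis using w by blast
  qed
  then obtain W where W: "\<And>p. W p \<in> tangent_space A p"
    "\<And>X p. X \<in> vector_fields A \<Longrightarrow> g p (X p) (W p) = F X p" by metis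
  have "smooth_fun A (\<lambda>p. W p f)" if f: "smooth_fun A f" for f
  proof (rule smooth_fun_quotient_local)
    fix p
    obtain N and E :: "'e basis_index \<Rightarrow> 'm field" where N: "open N" "p \<in> N" and E: "\<And>i. E i \<in> vector_fields A"
      and nz: "\<And>q. q \<in> N \<Longrightarrow> det (gram E q) \<noteq> 0"
      and expand: "\<And>q v f. v \<in> tangent_space A q \<Longrightarrow> det (gram E q) * v f =
        (\<Sum>i\<in>UNIV. cramer_det E (\<lambda>k. g q (E k q) v) i q * E i q f)"
      by (rule cramer_frame[of p]) (rule that)
    define C where "C i q = cramer_det E (\<lambda>k. F (E k) q) i q" for i q
    define K where "K q = (\<Sum>i\<in>UNIV. C i q * E i q f)" for q
    note d = smooth_fun_det_gram[of E, OF E]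
    have C: "smooth_fun A (C i)" for i
      unfolding C_def by (rule smooth_fun_cramer_det[of E "\<lambda>k. F (E k)", OF E smooth[OF E]])
    have K: "smooth_fun A K"
      unfolding K_def by (rule smooth_fun_sum, rule smooth_fun_mult[OF C field_smooth[OF E f]])
    have "det (gram E q) * W q f = K q" for q
      unfolding K_def C_def expand[OF W(1)] W(2)[OF E] ..
    then show "\<exists>N d K. open N \<and> p \<in> N \<and> smooth_fun A d \<and> smooth_fun A K \<and>
       (\<forall>q\<in>N. d q \<noteq> 0 \<and> d q * W q f = K q)"
      using N d K nz by (intro exI[of _ N] exI[of _ "\<lambda>q. det (gram E q)"] exI[of _ K]) auto
  qed
  then have "W \<in> vector_fields A" using W(1) by (simp add: vector_fields_def)
  then show ?thesis using W(2) by blast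
qed

end

section \<open>Metric conjugates\<close>

lemma fadd_apply: "fadd X Y p = tadd (X p) (Y p)"
  by (simp add: fadd_def)

lemma fscale_apply: "fscale f X p = tscale (f p) (X p)"
  by (simp add: fscale_def)

lemma linear_connectionD:
  assumes "D \<in> linear_connections A" "X \<in> vector_fields A" "Y \<in> vector_fields A"
  shows "D X Y \<in> vector_fields A"
    "X' \<in> vector_fields A \<Longrightarrow> D (fadd X X') Y = fadd (D X Y) (D X' Y)"
    "Y' \<in> vector_fields A \<Longrightarrow> D X (fadd Y Y') = fadd (D X Y) (D X Y')"
    "smooth_fun A f \<Longrightarrow> D (fscale f X) Y = fscale f (D X Y)"
    "smooth_fun A f \<Longrightarrow> D X (fscale f Y) = fadd (fscale (\<lambda>p. X p f) Y) (fscale f (D X Y))"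
  using assms unfolding linear_connections_def by (blast dest: PiE_mem)+

lemma linear_connection_eqI:
  assumes "D \<in> linear_connections A" "D' \<in> linear_connections A"
    "\<And>X Y. X \<in> vector_fields A \<Longrightarrow> Y \<in> vector_fields A \<Longrightarrow> D X Y = D' X Y"
  shows "D = D'"
proof -
  have D: "D \<in> vector_fields A \<rightarrow>\<^sub>E vector_fields A \<rightarrow>\<^sub>E vector_fields A"
    "D' \<in> vector_fields A \<rightarrow>\<^sub>E vector_fields A \<rightarrow>\<^sub>E vector_fields A"
    using assms(1,2) by (simp_all add: linear_connections_def)
  show ?thesis
  proof (rule PiE_ext[OF D])
    fix X assume X: "X \<in> vector_fields A"
    show "D X = D' X"
      by (rule PiE_ext[OF PiE_mem[OF D(1) X] PiE_mem[OF D(2) X]]) (rule assms(3)[OF X])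
  qed
qed

lemma is_metric_conjugateD:
  assumes "is_metric_conjugate A h D D'"
  shows "D' \<in> linear_connections A"
    "X \<in> vector_fields A \<Longrightarrow> Y \<in> vector_fields A \<Longrightarrow> Z \<in> vector_fields A \<Longrightarrow>
      Z p (\<lambda>q. h q (X q) (Y q)) = h p (D Z X p) (Y p) + h p (X p) (D' Z Y p)"
  using assms by (simp_all add: is_metric_conjugate_def)

context metric_manifold
begin

text \<open>
  The metric \<open>h\<close> is arbitrary, so that this and the two following results also apply to the twin
  metric; \<open>g\<close> is only used to extend a tangent vector to a vector field.
\<close>

lemma tangent_eqI:
  assumes h: "pseudo_riemannian_metric A h"
    and v: "v \<in> tangent_space A p" and w: "w \<in> tangent_space A p"
    and eq: "\<And>X. X \<in> vector_fields A \<Longrightarrow> h p (X p) v = h p (X p) w"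
  shows "v = w"
proof -
  let ?u = "tadd v (tscale (-1) w)"
  have w': "tscale (-1) w \<in> tangent_space A p" by (rule tangent_tscale[OF w])
  have u: "?u \<in> tangent_space A p" by (rule tangent_tadd[OF v w'])
  have "?u = (\<lambda>f. 0)"
  proof (rule metric_nondegenerate[OF h u])
    fix x assume x: "x \<in> tangent_space A p"
    obtain X where X: "X \<in> vector_fields A" "X p = x" using field_through_vector[OF x] .
    show "h p ?u x = 0"
      using eq[OF X(1)] X(2) metric_rules(1)[OF h x v] metric_rules(1)[OF h x w]
      by (simp add: metric_rules(4)[OF h v x w'] metric_rules(2)[OF h w x])
  qed
  then show ?thesis by (simp add: tadd_def tscale_def fun_eq_iff)
qed

lemma metric_conjugate_eqI:
  assumes h: "pseudo_riemannian_metric A h" and conj: "is_metric_conjugate A h D D'"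
  shows "metric_conjugate A h D = D'"
  unfolding metric_conjugate_def
proof (rule the_equality[where P = "is_metric_conjugate A h D", OF conj])
  fix D'' assume conj': "is_metric_conjugate A h D D''"
  have lc: "D' \<in> linear_connections A" "D'' \<in> linear_connections A"
    using conj conj' by (simp_all add: is_metric_conjugate_def)
  show "D'' = D'"
  proof (rule linear_connection_eqI[OF lc(2,1)])
    fix Z Y assume ZY: "Z \<in> vector_fields A" "Y \<in> vector_fields A"
    show "D'' Z Y = D' Z Y"
    proof
      fix p
      show "D'' Z Y p = D' Z Y p"
      proof (rule tangent_eqI[OF h])
        show "D'' Z Y p \<in> tangent_space A p" "D' Z Y p \<in> tangent_space A p"
          using linear_connectionD(1)[OF _ ZY] lc by (simp_all add: field_tangent)
        show "h p (X p) (D'' Z Y p) = h p (X p) (D' Z Y p)" if "X \<in> vector_fields A" for X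
          using is_metric_conjugateD(2)[OF conj that ZY(2,1), of p]
            is_metric_conjugateD(2)[OF conj' that ZY(2,1), of p] by simp
      qed
    qed
  qed
qed

lemma is_metric_conjugate_sym:
  assumes h: "pseudo_riemannian_metric A h" and D: "D \<in> linear_connections A"
    and conj: "is_metric_conjugate A h D D'"
  shows "is_metric_conjugate A h D' D"
  unfolding is_metric_conjugate_def
proof (intro conjI D ballI allI)
  fix X Y Z p assume XYZ: "X \<in> vector_fields A" "Y \<in> vector_fields A" "Z \<in> vector_fields A"
  have D': "D' \<in> linear_connections A" using conj by (simp add: is_metric_conjugate_def)
  note t = field_tangent[OF XYZ(1)] field_tangent[OF XYZ(2)]
    field_tangent[OF linear_connectionD(1)[OF D XYZ(3,2)]]
    field_tangent[OF linear_connectionD(1)[OF D' XYZ(3,1)]]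
  have "(\<lambda>q. h q (X q) (Y q)) = (\<lambda>q. h q (Y q) (X q))"
    by (rule ext) (rule metric_rules(1)[OF h t(1,2)])
  then have "Z p (\<lambda>q. h q (X q) (Y q)) = h p (D Z Y p) (X p) + h p (Y p) (D' Z X p)"
    using is_metric_conjugateD(2)[OF conj XYZ(2,1,3)] by simp
  then show "Z p (\<lambda>q. h q (X q) (Y q)) = h p (D' Z X p) (Y p) + h p (X p) (D Z Y p)"
    using metric_rules(1)[OF h t(1,3)] metric_rules(1)[OF h t(2,4)] by simp
qed

lemma field_eqI:
  assumes "V \<in> vector_fields A" "W \<in> vector_fields A"
    "\<And>X p. X \<in> vector_fields A \<Longrightarrow> g p (X p) (V p) = g p (X p) (W p)"
  shows "V = W"
proof
  show "V p = W p" for p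
    by (rule tangent_eqI[OF metric, of _ p]) (simp_all add: assms field_tangent)
qed

text \<open>
  For fixed \<open>Z\<close> and \<open>Y\<close> the expression \<open>Z (g X Y) - g (D Z X) Y\<close> is linear in \<open>X\<close> over the smooth
  functions, because the two Leibniz terms \<open>Z f * g X Y\<close> cancel. The field that represents it is the
  conjugate derivative of \<open>Y\<close> along \<open>Z\<close>. The axioms of a connection are then read off by
  testing against all \<open>X\<close>.
\<close>

lemma metric_conjugate_exists:
  assumes D: "D \<in> linear_connections A"
  obtains D' where "is_metric_conjugate A g D D'"
proof -
  note Dt = field_tangent[OF linear_connectionD(1)[OF D]]
  note m = metric_rules[OF metric]
  have ex: "\<exists>W\<in>vector_fields A. \<forall>X\<in>vector_fields A. \<forall>p.
      g p (X p) (W p) = Z p (\<lambda>q. g q (X q) (Y q)) - g p (D Z X p) (Y p)"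
    if Z: "Z \<in> vector_fields A" and Y: "Y \<in> vector_fields A" for Z Y
  proof -
    define F where "F X p = Z p (\<lambda>q. g q (X q) (Y q)) - g p (D Z X p) (Y p)" for X p
    note Zr = tangent_rules[OF field_tangent[OF Z]] and Yt = field_tangent[OF Y]
    note gs = metric_smooth[OF metric _ Y]
    have Fadd: "F (fadd X X') p = F X p + F X' p" if X: "X \<in> vector_fields A" "X' \<in> vector_fields A" for X X' p
    proof -
      have "(\<lambda>q. g q (fadd X X' q) (Y q)) = (\<lambda>q. g q (X q) (Y q) + g q (X' q) (Y q))"
        by (simp add: fadd_apply m(4) field_tangent X Y)
      moreover have "g p (D Z (fadd X X') p) (Y p) = g p (D Z X p) (Y p) + g p (D Z X' p) (Y p)"
        by (simp add: linear_connectionD(3)[OF D Z X] fadd_apply m(4) Dt Z X Yt)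
      ultimately show ?thesis by (simp add: F_def Zr(1) gs X)
    qed
    have Fscale: "F (fscale f X) p = f p * F X p" if f: "smooth_fun A f" and X: "X \<in> vector_fields A" for f X p
    proof -
      have "(\<lambda>q. g q (fscale f X q) (Y q)) = (\<lambda>q. f q * g q (X q) (Y q))"
        by (simp add: fscale_apply m(2) field_tangent X Y)
      moreover have "g p (D Z (fscale f X) p) (Y p) = Z p f * g p (X p) (Y p) + f p * g p (D Z X p) (Y p)"
        by (simp add: linear_connectionD(5)[OF D Z X f] fadd_apply fscale_apply m(2,4) Dt Z X Yt
            field_tangent tangent_tscale)
      ultimately show ?thesis by (simp add: F_def Zr(2) gs X f algebra_simps)
    qed
    have Fsmooth: "smooth_fun A (F X)" if X: "X \<in> vector_fields A" for X
      unfolding F_def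
      by (rule smooth_fun_diff[OF field_smooth[OF Z gs[OF X]] gs[OF linear_connectionD(1)[OF D Z X]]])
    have "\<exists>W\<in>vector_fields A. \<forall>X\<in>vector_fields A. \<forall>p. g p (X p) (W p) = F X p"
      by (rule functional_representation[of F]) (rule Fadd Fscale Fsmooth; assumption)+
    then show ?thesis unfolding F_def .
  qed
  define W where "W Z Y = (SOME W. W \<in> vector_fields A \<and> (\<forall>X\<in>vector_fields A. \<forall>p.
      g p (X p) (W p) = Z p (\<lambda>q. g q (X q) (Y q)) - g p (D Z X p) (Y p)))" for Z Y
  have W_both: "W Z Y \<in> vector_fields A \<and> (\<forall>X\<in>vector_fields A. \<forall>p.
      g p (X p) (W Z Y p) = Z p (\<lambda>q. g q (X q) (Y q)) - g p (D Z X p) (Y p))"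
    if "Z \<in> vector_fields A" "Y \<in> vector_fields A" for Z Y
    unfolding W_def by (rule someI_ex[OF ex[OF that, unfolded Bex_def]])
  have WV: "W Z Y \<in> vector_fields A" if "Z \<in> vector_fields A" "Y \<in> vector_fields A" for Z Y
    using W_both[OF that] by (rule conjunct1)
  have W: "g p (X p) (W Z Y p) = Z p (\<lambda>q. g q (X q) (Y q)) - g p (D Z X p) (Y p)"
    if "Z \<in> vector_fields A" "Y \<in> vector_fields A" "X \<in> vector_fields A" for X Y Z p
    using conjunct2[OF W_both[OF that(1,2)]] that(3) by simp
  note Wt = field_tangent[OF WV]
  define D' where "D' = (\<lambda>Z\<in>vector_fields A. \<lambda>Y\<in>vector_fields A. W Z Y)"
  have D': "D' Z Y = W Z Y" if "Z \<in> vector_fields A" "Y \<in> vector_fields A" for Z Y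
    using that by (simp add: D'_def)
  have "D' \<in> linear_connections A"
    unfolding linear_connections_def
  proof (intro CollectI conjI ballI allI impI)
    show "D' \<in> vector_fields A \<rightarrow>\<^sub>E vector_fields A \<rightarrow>\<^sub>E vector_fields A"
      unfolding D'_def using WV by auto
    fix Z Y assume Z: "Z \<in> vector_fields A" and Y: "Y \<in> vector_fields A"
    show "D' (fadd Z Z') Y = fadd (D' Z Y) (D' Z' Y)" if Z': "Z' \<in> vector_fields A" for Z'
      unfolding D'[OF Z Y] D'[OF Z' Y] D'[OF field_fadd[OF Z Z'] Y]
    proof (rule field_eqI)
      fix X p assume X: "X \<in> vector_fields A"
      show "g p (X p) (W (fadd Z Z') Y p) = g p (X p) (fadd (W Z Y) (W Z' Y) p)"
        by (simp add: W field_fadd Z Z' Y X fadd_apply m(5) Wt field_tangent)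
           (simp add: W Z Z' Y X linear_connectionD(2)[OF D Z X Z']
            m(4) fadd_apply Dt field_tangent tadd_def[of "Z p" "Z' p"])
    qed (intro field_fadd WV Z Z' Y)+
    show "D' Z (fadd Y Y') = fadd (D' Z Y) (D' Z Y')" if Y': "Y' \<in> vector_fields A" for Y'
      unfolding D'[OF Z Y] D'[OF Z Y'] D'[OF Z field_fadd[OF Y Y']]
    proof (rule field_eqI)
      fix X p assume X: "X \<in> vector_fields A"
      have "(\<lambda>q. g q (X q) (fadd Y Y' q)) = (\<lambda>q. g q (X q) (Y q) + g q (X q) (Y' q))"
        by (simp add: fadd_apply m(5) field_tangent X Y Y')
      then have "g p (X p) (W Z (fadd Y Y') p) = g p (X p) (W Z Y p) + g p (X p) (W Z Y' p)"
        by (simp add: W Z field_fadd Y Y' X tangent_rules(1)[OF field_tangent[OF Z]] metric_smooth[OF metric])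
           (simp add: fadd_apply m(5) field_tangent Dt Z X Y Y')
      then show "g p (X p) (W Z (fadd Y Y') p) = g p (X p) (fadd (W Z Y) (W Z Y') p)"
        by (simp add: fadd_apply m(5) field_tangent X Wt Z Y Y')
    qed (intro field_fadd WV Z Y' Y)+
    fix f assume f: "smooth_fun A f"
    show "D' (fscale f Z) Y = fscale f (D' Z Y)"
      unfolding D'[OF Z Y] D'[OF field_fscale[OF Z f] Y]
    proof (rule field_eqI)
      fix X p assume X: "X \<in> vector_fields A"
      have "g p (X p) (W (fscale f Z) Y p) = f p * g p (X p) (W Z Y p)"
        by (simp add: W field_fscale f Z Y X linear_connectionD(4)[OF D Z X f])
           (simp add: fscale_apply m(2) Dt field_tangent X Y Z tscale_def[of "f p" "Z p"] algebra_simps)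
      then show "g p (X p) (W (fscale f Z) Y p) = g p (X p) (fscale f (W Z Y) p)"
        by (simp add: fscale_apply m(3) field_tangent X Wt Z Y)
    qed (intro field_fscale WV Z Y f)+
    show "D' Z (fscale f Y) = fadd (fscale (\<lambda>p. Z p f) Y) (fscale f (D' Z Y))"
      unfolding D'[OF Z Y] D'[OF Z field_fscale[OF Y f]]
    proof (rule field_eqI)
      fix X p assume X: "X \<in> vector_fields A"
      have "(\<lambda>q. g q (X q) (fscale f Y q)) = (\<lambda>q. f q * g q (X q) (Y q))"
        by (simp add: fscale_apply m(3) field_tangent X Y)
      then have "g p (X p) (W Z (fscale f Y) p) = Z p f * g p (X p) (Y p) + f p * g p (X p) (W Z Y p)"
        by (simp add: W Z field_fscale Y f X tangent_rules(2)[OF field_tangent[OF Z]] metric_smooth[OF metric])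
           (simp add: fscale_apply m(3) field_tangent Dt Z X Y algebra_simps)
      then show "g p (X p) (W Z (fscale f Y) p) = g p (X p) (fadd (fscale (\<lambda>p. Z p f) Y) (fscale f (W Z Y)) p)"
        by (simp add: fadd_apply fscale_apply m(3,5) field_tangent X Wt Z Y tangent_tscale)
    qed (simp_all add: WV field_fadd field_fscale field_smooth[OF Z f] Z Y f)
  qed
  then have "is_metric_conjugate A g D D'"
    unfolding is_metric_conjugate_def by (simp add: D' W)
  then show ?thesis by (rule that)
qed

end

section \<open>J-conjugates and the Klein group\<close>

locale anti_Hermitian_manifold = metric_manifold A g r s
  for A :: "('m::{t2_space, second_countable_topology}, 'e::euclidean_space) chart set" and g r s +
  fixes J :: "'m endomorphism"
  assumes J: "almost_complex_structure A J"
    and anti: "u \<in> tangent_space A p \<Longrightarrow> v \<in> tangent_space A p \<Longrightarrow> g p (J p u) (J p v) = - g p u v"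
begin

lemma J_rules:
  assumes "u \<in> tangent_space A p"
  shows "J p u \<in> tangent_space A p" "J p (J p u) = tscale (-1) u" "J p (tscale c u) = tscale c (J p u)"
    "v \<in> tangent_space A p \<Longrightarrow> J p (tadd u v) = tadd (J p u) (J p v)"
  using J assms unfolding almost_complex_structure_def by blast+

definition J_field :: "'m field \<Rightarrow> 'm field" where "J_field X = (\<lambda>p. J p (X p))"

lemma J_field_closed: "X \<in> vector_fields A \<Longrightarrow> J_field X \<in> vector_fields A"
  using J unfolding almost_complex_structure_def J_field_def by blast

text \<open>
  Since \<open>J\<^sup>2 = -1\<close>, the inverse in the definition of the J-conjugate is \<open>-J\<close>.
\<close>

lemma J_inverse:
  assumes u: "u \<in> tangent_space A p"
  shows "inv_into (tangent_space A p) (J p) u = tscale (-1) (J p u)"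
proof (rule inv_into_f_eq)
  have neg: "tscale (-1) (tscale (-1) v) = v" for v :: "'m tangent" by (simp add: tscale_def)
  show "inj_on (J p) (tangent_space A p)"
    by (rule inj_on_inverseI[where g = "\<lambda>v. tscale (-1) (J p v)"]) (simp add: J_rules neg)
  show "tscale (-1) (J p u) \<in> tangent_space A p" by (intro tangent_tscale J_rules u)
  show "J p (tscale (-1) (J p u)) = u" using u by (simp add: J_rules neg)
qed

lemma metric_J:
  assumes u: "u \<in> tangent_space A p" and v: "v \<in> tangent_space A p"
  shows "g p (J p u) v = g p u (J p v)"
proof -
  have "g p (J p u) v = - g p (J p (J p u)) (J p v)" using anti[of "J p u" p v] u v J_rules(1) by simp
  then show ?thesis using u v by (simp add: J_rules metric_rules(2)[OF metric])
qed

lemma pseudo_riemannian_twin_metric: "pseudo_riemannian_metric A (twin_metric J g)"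
proof -
  have nondegenerate: "u = (\<lambda>f. 0)" if u: "u \<in> tangent_space A p"
    and z: "\<And>v. v \<in> tangent_space A p \<Longrightarrow> g p (J p u) v = 0" for p u
  proof (rule metric_nondegenerate[OF metric u])
    fix v assume v: "v \<in> tangent_space A p"
    show "g p u v = 0" using anti[OF u v] z[of "J p v"] v J_rules(1) by simp
  qed
  have smooth: "smooth_fun A (\<lambda>p. g p (J p (X p)) (Y p))"
    if "X \<in> vector_fields A" "Y \<in> vector_fields A" for X Y
    using metric_smooth[OF metric J_field_closed[OF that(1)] that(2)] by (simp add: J_field_def)
  have sym: "g p (J p u) v = g p (J p v) u"
    if "u \<in> tangent_space A p" "v \<in> tangent_space A p" for p u v
    using metric_J[OF that] metric_rules(1)[OF metric that(1) J_rules(1)[OF that(2)]] by simp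
  show ?thesis
    unfolding pseudo_riemannian_metric_def twin_metric_def
  proof (intro conjI allI ballI impI)
    fix p u v assume u: "u \<in> tangent_space A p" and v: "v \<in> tangent_space A p"
    show "g p (J p u) v = g p (J p v) u" by (rule sym[OF u v])
    show "g p (J p (tscale c u)) v = c * g p (J p u) v" for c
      using u v by (simp add: J_rules metric_rules(2)[OF metric])
    show "g p (J p (tadd u w)) v = g p (J p u) v + g p (J p w) v" if "w \<in> tangent_space A p" for w
      using u v that by (simp add: J_rules metric_rules(4)[OF metric])
  next
    fix p u assume "u \<in> tangent_space A p" "\<forall>v\<in>tangent_space A p. g p (J p u) v = 0"
    then show "u = (\<lambda>f. 0)" using nondegenerate by blast
  qed (rule smooth)
qed

lemma J_conjugate_apply:
  assumes "D \<in> linear_connections A" "X \<in> vector_fields A" "Y \<in> vector_fields A"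
  shows "J_conjugate A J D X Y = fscale (\<lambda>_. -1) (J_field (D X (J_field Y)))"
proof
  fix p
  have "D X (J_field Y) p \<in> tangent_space A p"
    by (rule field_tangent[OF linear_connectionD(1)[OF assms(1,2) J_field_closed[OF assms(3)]]])
  from J_inverse[OF this]
  show "J_conjugate A J D X Y p = fscale (\<lambda>_. -1) (J_field (D X (J_field Y))) p"
    using assms(2,3) by (simp add: J_conjugate_def J_field_def fscale_def)
qed

lemma J_field_rules:
  assumes "X \<in> vector_fields A"
  shows "J_field (fscale f X) = fscale f (J_field X)"
    "J_field (J_field X) = fscale (\<lambda>_. -1) X"
    "Y \<in> vector_fields A \<Longrightarrow> J_field (fadd X Y) = fadd (J_field X) (J_field Y)"
  using assms by (simp_all add: J_field_def fscale_def fadd_def J_rules field_tangent)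

lemma J_conjugate_connection:
  assumes D: "D \<in> linear_connections A"
  shows "J_conjugate A J D \<in> linear_connections A"
  unfolding linear_connections_def
proof (intro CollectI conjI ballI allI impI)
  note closed = linear_connectionD(1)[OF D] J_field_closed field_fadd field_fscale smooth_fun_const
  have c: "J_conjugate A J D X Y \<in> vector_fields A" if "X \<in> vector_fields A" "Y \<in> vector_fields A" for X Y
    using that by (simp add: J_conjugate_apply[OF D] closed)
  then show "J_conjugate A J D \<in> vector_fields A \<rightarrow>\<^sub>E vector_fields A \<rightarrow>\<^sub>E vector_fields A"
    by (auto simp: J_conjugate_def PiE_def extensional_def)
  fix X Y assume X: "X \<in> vector_fields A" and Y: "Y \<in> vector_fields A"
  note JY = J_field_closed[OF Y]
  note unfold = fadd_def fscale_def tadd_def tscale_def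
  show "J_conjugate A J D (fadd X X') Y = fadd (J_conjugate A J D X Y) (J_conjugate A J D X' Y)"
    if X': "X' \<in> vector_fields A" for X'
    by (simp add: J_conjugate_apply[OF D] closed X X' Y linear_connectionD(2)[OF D X JY X'] J_field_rules)
       (simp add: unfold algebra_simps)
  show "J_conjugate A J D X (fadd Y Y') = fadd (J_conjugate A J D X Y) (J_conjugate A J D X Y')"
    if Y': "Y' \<in> vector_fields A" for Y'
    by (simp add: J_conjugate_apply[OF D] closed X Y' Y J_field_rules
        linear_connectionD(3)[OF D X JY J_field_closed[OF Y']])
       (simp add: unfold algebra_simps)
  fix f assume f: "smooth_fun A f"
  show "J_conjugate A J D (fscale f X) Y = fscale f (J_conjugate A J D X Y)"
    by (simp add: J_conjugate_apply[OF D] closed X Y f J_field_rules linear_connectionD(4)[OF D X JY f])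
       (simp add: unfold algebra_simps)
  show "J_conjugate A J D X (fscale f Y) = fadd (fscale (\<lambda>p. X p f) Y) (fscale f (J_conjugate A J D X Y))"
    by (simp add: J_conjugate_apply[OF D] closed X Y f J_field_rules field_smooth[OF X f]
        linear_connectionD(5)[OF D X JY f])
       (simp add: unfold algebra_simps)
qed

lemma J_conjugate_J_conjugate:
  assumes D: "D \<in> linear_connections A"
  shows "J_conjugate A J (J_conjugate A J D) = D"
proof (rule linear_connection_eqI[OF _ D])
  show "J_conjugate A J (J_conjugate A J D) \<in> linear_connections A"
    by (intro J_conjugate_connection D)
  fix X Y assume X: "X \<in> vector_fields A" and Y: "Y \<in> vector_fields A"
  have neg: "fscale (\<lambda>_. -1) (fscale (\<lambda>_. -1) V) = V" for V :: "'m field"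
    by (simp add: fscale_def tscale_def)
  \<comment> \<open>the Leibniz rule for a constant function\<close>
  have neg_conn: "D X (fscale (\<lambda>_. -1) Y) = fscale (\<lambda>_. -1) (D X Y)"
    using linear_connectionD(5)[OF D X Y smooth_fun_const[of "-1"]]
      tangent_const[OF field_tangent[OF X]]
    by (simp add: fadd_def fscale_def tadd_def tscale_def)
  show "J_conjugate A J (J_conjugate A J D) X Y = D X Y"
    using X Y D by (simp add: J_conjugate_apply J_conjugate_connection J_field_closed J_field_rules
        neg_conn neg linear_connectionD(1) field_fscale smooth_fun_const)
qed

text \<open>
  Both parts rest on \<open>g (J u) (J\<^sup>-\<^sup>1 v) = g u v\<close>. For the first, \<open>G X Y = g X (J Y)\<close> is differentiated
  with the conjugation rule for \<open>g\<close>; for the second, \<open>g X Y = - g (J X) (J Y)\<close>.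
\<close>

lemma J_conjugate_metric_conjugate:
  assumes D: "D \<in> linear_connections A" and conj: "is_metric_conjugate A g D D'"
  shows "is_metric_conjugate A (twin_metric J g) D (J_conjugate A J D')"
    and "is_metric_conjugate A g (J_conjugate A J D) (J_conjugate A J D')"
proof -
  have D': "D' \<in> linear_connections A" using conj by (simp add: is_metric_conjugate_def)
  have eq: "Z p (\<lambda>q. g q (X q) (Y q)) = g p (D Z X p) (Y p) + g p (X p) (D' Z Y p)"
    if "X \<in> vector_fields A" "Y \<in> vector_fields A" "Z \<in> vector_fields A" for X Y Z p
    using conj that by (simp add: is_metric_conjugate_def)
  note m = metric_rules[OF metric]
  \<comment> \<open>\<open>J\<close> and the inverse of \<open>J\<close> in the J-conjugate cancel against each other\<close>
  have Jconj: "g p (J p u) (J_conjugate A J D' Z Y p) = g p u (D' Z (J_field Y) p)"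
    if "u \<in> tangent_space A p" "Z \<in> vector_fields A" "Y \<in> vector_fields A" for u p Z Y
  proof -
    have t: "D' Z (J_field Y) p \<in> tangent_space A p"
      by (rule field_tangent[OF linear_connectionD(1)[OF D' that(2) J_field_closed[OF that(3)]]])
    then show ?thesis
      using that anti[OF that(1) t]
      by (simp add: J_conjugate_apply[OF D'] fscale_apply m(3) J_rules J_field_def)
  qed
  show "is_metric_conjugate A (twin_metric J g) D (J_conjugate A J D')"
    unfolding is_metric_conjugate_def
  proof (intro conjI ballI allI J_conjugate_connection D')
    fix X Y Z p assume X: "X \<in> vector_fields A" and Y: "Y \<in> vector_fields A" and Z: "Z \<in> vector_fields A"
    have "(\<lambda>q. twin_metric J g q (X q) (Y q)) = (\<lambda>q. g q (X q) (J_field Y q))"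
      by (simp add: twin_metric_def J_field_def metric_J field_tangent X Y)
    then have "Z p (\<lambda>q. twin_metric J g q (X q) (Y q))
        = g p (D Z X p) (J p (Y p)) + g p (X p) (D' Z (J_field Y) p)"
      using eq[OF X J_field_closed[OF Y] Z] by (simp add: J_field_def)
    then show "Z p (\<lambda>q. twin_metric J g q (X q) (Y q))
        = twin_metric J g p (D Z X p) (Y p) + twin_metric J g p (X p) (J_conjugate A J D' Z Y p)"
      by (simp add: twin_metric_def Jconj metric_J field_tangent linear_connectionD(1)[OF D] X Y Z)
  qed
  show "is_metric_conjugate A g (J_conjugate A J D) (J_conjugate A J D')"
    unfolding is_metric_conjugate_def
  proof (intro conjI ballI allI J_conjugate_connection D')
    fix X Y Z p assume X: "X \<in> vector_fields A" and Y: "Y \<in> vector_fields A" and Z: "Z \<in> vector_fields A"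
    note JX = J_field_closed[OF X] and JY = J_field_closed[OF Y]
    have DJX: "D Z (J_field X) p \<in> tangent_space A p"
      by (rule field_tangent[OF linear_connectionD(1)[OF D Z JX]])
    have "(\<lambda>q. g q (X q) (Y q)) = (\<lambda>q. -1 * g q (J_field X q) (J_field Y q))"
      by (simp add: J_field_def anti field_tangent X Y)
    then have "Z p (\<lambda>q. g q (X q) (Y q))
        = - g p (D Z (J_field X) p) (J p (Y p)) - g p (J p (X p)) (D' Z (J_field Y) p)"
      using eq[OF JX JY Z] tangent_rules(3)[OF field_tangent[OF Z] metric_smooth[OF metric JX JY], of p "-1"]
      by (simp add: J_field_def)
    moreover have "- g p (D Z (J_field X) p) (J p (Y p)) = g p (J_conjugate A J D Z X p) (Y p)"
      using DJX by (simp add: J_conjugate_apply[OF D Z X] fscale_apply J_field_def[of "D Z (J_field X)"]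
          m(2) J_rules metric_J field_tangent Y)
    moreover have "- g p (J p (X p)) (D' Z (J_field Y) p) = g p (X p) (J_conjugate A J D' Z Y p)"
      using Jconj[OF J_rules(1)[OF field_tangent[OF X]] Z Y, of p]
      by (simp add: J_rules field_tangent X m(2) linear_connectionD(1)[OF J_conjugate_connection[OF D']] Y Z)
    ultimately show "Z p (\<lambda>q. g q (X q) (Y q))
        = g p (J_conjugate A J D Z X p) (Y p) + g p (X p) (J_conjugate A J D' Z Y p)" by simp
  qed
qed

end

theorem theorem1:
  fixes A :: "('m::{t2_space, second_countable_topology}, 'e::euclidean_space) chart set"
    and J :: "'m endomorphism"
    and g G :: "'m bilinear_form"
    and n :: nat
    and D :: "'m connection"
  assumes "almost_anti_Hermitian n A J g G"
    and "D \<in> linear_connections A"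
  shows "let star = metric_conjugate A g;
             dagger = metric_conjugate A G;
             jay = J_conjugate A J
         in star D \<in> linear_connections A \<and>
            dagger D \<in> linear_connections A \<and>
            jay D \<in> linear_connections A \<and>
            star (star D) = D \<and> dagger (dagger D) = D \<and> jay (jay D) = D \<and>
            jay (dagger D) = star D \<and> dagger (jay D) = star D \<and>
            jay (star D) = dagger D \<and> star (jay D) = dagger D \<and>
            dagger (star D) = jay D \<and> star (dagger D) = jay D"
proof -
  interpret anti_Hermitian_manifold A g n n J
    using assms(1) unfolding almost_anti_Hermitian_def by unfold_locales auto
  have G: "G = twin_metric J g" using assms(1) by (simp add: almost_anti_Hermitian_def)
  define star where "star = metric_conjugate A g"
  define dagger where "dagger = metric_conjugate A G"
  define jay where "jay = J_conjugate A J"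
  have star: "is_metric_conjugate A g D (star D)" if "D \<in> linear_connections A" for D
    unfolding star_def
    using metric_conjugate_exists[OF that] metric_conjugate_eqI[OF metric] by metis
  then have star_closed: "star D \<in> linear_connections A" if "D \<in> linear_connections A" for D
    using that by (simp add: is_metric_conjugate_def)
  have jay_closed: "jay D \<in> linear_connections A" if "D \<in> linear_connections A" for D
    unfolding jay_def by (rule J_conjugate_connection[OF that])
  have star_star: "star (star D) = D" if "D \<in> linear_connections A" for D
    using metric_conjugate_eqI[OF metric is_metric_conjugate_sym[OF metric that star[OF that]]]
    by (simp add: star_def)
  have jay_jay: "jay (jay D) = D" if "D \<in> linear_connections A" for D
    unfolding jay_def by (rule J_conjugate_J_conjugate[OF that])
  have dagger: "dagger D = jay (star D)" if "D \<in> linear_connections A" for D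
    using metric_conjugate_eqI[OF pseudo_riemannian_twin_metric J_conjugate_metric_conjugate(1)[OF that star[OF that]]]
    by (simp add: dagger_def jay_def G)
  have star_jay: "star (jay D) = jay (star D)" if "D \<in> linear_connections A" for D
    using metric_conjugate_eqI[OF metric J_conjugate_metric_conjugate(2)[OF that star[OF that]]]
    by (simp add: star_def jay_def)
  \<comment> \<open>every composite reduces to a word in the two commuting involutions \<open>star\<close> and \<open>jay\<close>\<close>
  show ?thesis
    unfolding Let_def star_def[symmetric] dagger_def[symmetric] jay_def[symmetric]
    using assms(2) by (simp add: dagger star_jay star_star jay_jay star_closed jay_closed)
qed

end
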